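(* Let $(a_i,b_i)$, $i=1,\dots,n$, be training examples with $a_i\in\mathbb{R}^d$, let $\lambda>0$, and assume the loss $\ell(z,b)$ is, as a function of $z\in\mathbb{R}$, nonnegative, convex, smooth (differentiable with Lipschitz continuous derivative) and semi-algebraic. Let $F$ be either the objective $$F(x)=\frac1n\sum_{i=1}^n\ell(x^\top a_i,b_i)+\lambda R(x),\qquad x\in\mathbb{R}^d,$$ where $R(x)=\|x\|_p^s$ with $s\in\mathbb{N}$ (a positive integer) and $p\ge1$ a rational number, or $R$ is the Huber norm; or the objective $$F(x_1,\dots,x_M)=\frac1n\sum_{i=1}^n\sum_{m=1}^M\ell(x_m^\top a_i,b_{im})+\lambda\sum_{m=1}^M\|x_m\|_p,\qquad x_1,\dots,x_M\in\mathbb{R}^d,$$ with $p\ge1$ a rational number. Then for every $\xi>0$, $F$ satisfies the HEB condition with some $\theta\in(0,1]$ on the sublevel set $\mathcal{S}_\xi$. Hence the proximal gradient method PG has a global convergence speed of $o(1/t)$: for any starting point $x_0$, $F(x_{t+1})-F_*=o(1/t)$ and $\min_{1\le\tau\le t}\|G(x_\tau)\|_2=o(1/t)$ as $t\to\infty$.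
   Context: Write $F=f+g$ with $f$ the average loss term (convex and $L$-smooth, i.e. with $L$-Lipschitz gradient, $L>0$) and $g$ the regularization term. The Huber norm is $R(x)=\sum_{i=1}^dh(x_i)$ with, for a fixed $\delta>0$, $h(x)=\delta(|x|-\delta/2)$ if $|x|\ge\delta$ and $h(x)=x^2/2$ otherwise. A subset $S\subset\mathbb{R}^m$ is semi-algebraic if there are finitely many real polynomials $g_{ij},h_{ij}$ with $S=\bigcup_{j}\bigcap_{i}\{u: g_{ij}(u)=0\text{ and }h_{ij}(u)\le0\}$; a function is semi-algebraic if its graph is a semi-algebraic set. $\Omega_*$ is the set of minimizers of $F$, $F_*$ the minimum value, $D(x,\Omega_* )=\min_{y\in\Omega_*}\|x-y\|_2$, $\mathcal{S}_\xi=\{x:F(x)-F_*\le\xi\}$. HEB condition with $\theta\in(0,1]$ on $\mathcal{S}_\xi$: there is $0<c<\infty$ with $D(x,\Omega_* )\le c\,(F(x)-F_* )^\theta$ for all $x\in\mathcal{S}_\xi$. Proximal mapping: $P_{\eta g}(u)=\arg\min_{x}\frac12\|x-u\|_2^2+\eta g(x)$. Proximal gradient: $G(x)=L(x-x^+)$ with $x^+=P_{g/L}(x-\nabla f(x)/L)$. PG: $x_1=x_0$ and $x_{\tau+1}=P_{g/L}(x_\tau-\nabla f(x_\tau)/L)$ for $\tau\ge1$. *)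

theory Defs
  imports "HOL-Analysis.Analysis" "HOL-Library.Landau_Symbols"
begin

text \<open>On a Euclidean space, the library's \<open>real_polynomial_function\<close> (generated from linear forms and
  constants by sums and products) is exactly the polynomials in the coordinates.\<close>

definition semialgebraic :: "'a::euclidean_space set \<Rightarrow> bool" where
  "semialgebraic S \<longleftrightarrow>
     (\<exists>(k::nat) (l::nat) (g :: nat \<Rightarrow> nat \<Rightarrow> 'a \<Rightarrow> real) (h :: nat \<Rightarrow> nat \<Rightarrow> 'a \<Rightarrow> real).
        (\<forall>i<l. \<forall>j<k. real_polynomial_function (g i j) \<and> real_polynomial_function (h i j)) \<and>
        S = (\<Union>j<k. \<Inter>i<l. {u. g i j u = 0 \<and> h i j u \<le> 0}))"

definition semialgebraic_function :: "('a::euclidean_space \<Rightarrow> 'b::euclidean_space) \<Rightarrow> bool" where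
  "semialgebraic_function f \<longleftrightarrow> semialgebraic {(x, f x) | x. True}"

definition lp_norm :: "real \<Rightarrow> real^'d \<Rightarrow> real" where
  "lp_norm p x = (\<Sum>i\<in>UNIV. \<bar>x $ i\<bar> powr p) powr (1 / p)"

definition huber_scalar :: "real \<Rightarrow> real \<Rightarrow> real" where
  "huber_scalar \<delta> u = (if \<bar>u\<bar> \<ge> \<delta> then \<delta> * (\<bar>u\<bar> - \<delta> / 2) else u\<^sup>2 / 2)"

definition huber_norm :: "real \<Rightarrow> real^'d \<Rightarrow> real" where
  "huber_norm \<delta> x = (\<Sum>i\<in>UNIV. huber_scalar \<delta> (x $ i))"

definition avg_loss ::
  "(real \<Rightarrow> 'b \<Rightarrow> real) \<Rightarrow> nat \<Rightarrow> (nat \<Rightarrow> real^'d) \<Rightarrow> (nat \<Rightarrow> 'b) \<Rightarrow> real^'d \<Rightarrow> real" where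
  "avg_loss loss n a b x = (1 / real n) * (\<Sum>i=1..n. loss (x \<bullet> a i) (b i))"

text \<open>The tuple \<open>(x\<^sub>1, \<dots>, x\<^sub>M)\<close> is an element of \<open>real^'d^'m\<close>, whose norm is the Euclidean norm of
  the concatenated vector.\<close>

definition multi_avg_loss ::
  "(real \<Rightarrow> 'b \<Rightarrow> real) \<Rightarrow> nat \<Rightarrow> (nat \<Rightarrow> real^'d) \<Rightarrow> (nat \<Rightarrow> 'm \<Rightarrow> 'b) \<Rightarrow> real^'d^'m \<Rightarrow> real" where
  "multi_avg_loss loss n a b x =
     (1 / real n) * (\<Sum>i=1..n. \<Sum>m\<in>UNIV. loss ((x $ m) \<bullet> a i) (b i m))"

definition minimizers :: "('a \<Rightarrow> real) \<Rightarrow> 'a set" where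
  "minimizers F = {x. \<forall>y. F x \<le> F y}"

definition min_value :: "('a \<Rightarrow> real) \<Rightarrow> real" where
  "min_value F = (INF x. F x)"

definition sublevel :: "('a \<Rightarrow> real) \<Rightarrow> real \<Rightarrow> 'a set" where
  "sublevel F \<xi> = {x. F x - min_value F \<le> \<xi>}"

text \<open>Existence of a minimizer is part of the condition: \<open>infdist x {} = 0\<close> would otherwise make it
  trivially true. The set of minimizers of a continuous function is closed, so \<open>infdist\<close> is then the
  attained minimal distance, and \<open>min_value\<close> is the attained minimum.\<close>

definition HEB_on :: "('a::euclidean_space \<Rightarrow> real) \<Rightarrow> real \<Rightarrow> 'a set \<Rightarrow> bool" where
  "HEB_on F \<theta> S \<longleftrightarrow>
     minimizers F \<noteq> {} \<and>
     (\<exists>c>0. \<forall>x\<in>S. infdist x (minimizers F) \<le> c * (F x - min_value F) powr \<theta>)"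

definition gradient :: "('a::euclidean_space \<Rightarrow> real) \<Rightarrow> 'a \<Rightarrow> 'a" where
  "gradient f x = (THE D. GDERIV f x :> D)"

definition L_smooth :: "real \<Rightarrow> ('a::euclidean_space \<Rightarrow> real) \<Rightarrow> bool" where
  "L_smooth L f \<longleftrightarrow> (\<forall>x. f differentiable (at x)) \<and> L-lipschitz_on UNIV (gradient f)"

definition prox :: "real \<Rightarrow> ('a::euclidean_space \<Rightarrow> real) \<Rightarrow> 'a \<Rightarrow> 'a" where
  "prox \<eta> g u = arg_min (\<lambda>x. 1 / 2 * (norm (x - u))\<^sup>2 + \<eta> * g x) (\<lambda>x. True)"

definition prox_step ::
  "real \<Rightarrow> ('a::euclidean_space \<Rightarrow> real) \<Rightarrow> ('a \<Rightarrow> real) \<Rightarrow> 'a \<Rightarrow> 'a" where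
  "prox_step L f g x = prox (1 / L) g (x - (1 / L) *\<^sub>R gradient f x)"

definition prox_gradient ::
  "real \<Rightarrow> ('a::euclidean_space \<Rightarrow> real) \<Rightarrow> ('a \<Rightarrow> real) \<Rightarrow> 'a \<Rightarrow> 'a" where
  "prox_gradient L f g x = L *\<^sub>R (x - prox_step L f g x)"

fun PG :: "real \<Rightarrow> ('a::euclidean_space \<Rightarrow> real) \<Rightarrow> ('a \<Rightarrow> real) \<Rightarrow> 'a \<Rightarrow> nat \<Rightarrow> 'a" where
  "PG L f g x0 0 = x0"
| "PG L f g x0 (Suc 0) = x0"
| "PG L f g x0 (Suc (Suc t)) = prox_step L f g (PG L f g x0 (Suc t))"

end

theory Submission
  imports Defs
begin

text \<open>The Hoelder error bound is obtained without the general Lojasiewicz inequality, from the structure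
of the two objectives. Let \<open>xs\<close> be a minimizer of \<open>F\<close>. By the first-order condition,
\<open>F x - F xs\<close> is a sum of nonnegative gaps between a convex function and a supporting affine
function: one for each loss, evaluated at a linear form of \<open>x\<close>, and one for the regularizer
(\<open>F_gap_error_bound\<close>). The zero set of each gap is a polyhedron, and each gap dominates, on bounded
sets, some power of the violation of every linear constraint of its polyhedron. This property,
\<open>polyhedral_error_bound\<close>, passes to sums and to linear preimages. So \<open>F - F xs\<close> has it, and the minimizers
of \<open>F\<close> form a polyhedron. Hoffman's bound (\<open>hoffman_bound\<close>) estimates the distance to this
polyhedron by the sum of the violations, which gives the HEB condition on every bounded sublevel set
(\<open>HEB_on_polyhedral\<close>).

Semialgebraicity is used only for functions of one variable. A semialgebraic function satisfies a nonzero
polynomial equation \<open>Q(z, \<phi> z) = 0\<close> (\<open>semialgebraic_imp_algebraic_fun\<close>), and after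
factoring out \<open>y\<close> the equation bounds a gap from below by the absolute value of a nonzero polynomial in
\<open>z\<close>, hence by a power of the distance to the interval where the gap vanishes
(\<open>convex_algebraic_polyhedral_gaps\<close>). This covers the losses, the scalar Huber function and
\<open>\<bar>z\<bar> powr p\<close> for rational \<open>p\<close>, and then all separable sums. The \<open>\<ell>\<^sub>p\<close>-norm is reached from its
separable \<open>p\<close>-th power by homogeneity (\<open>polyhedral_gaps_of_powr\<close>), and the powers \<open>N\<^sup>s\<close> are reached
from the norm (\<open>polyhedral_gaps_power\<close>).

The rates of the proximal gradient method follow from convexity and smoothness, without the error
bound (\<open>PG_little_o\<close>): the gaps
\<open>F (x\<^sub>t) - min F\<close> decrease and are summable, hence are \<open>o(1/t)\<close>, and the squared proximal gradients are
bounded by the successive decrements.\<close>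

section \<open>Functions on the line with an algebraic graph\<close>

definition poly2 :: "real poly poly \<Rightarrow> real \<Rightarrow> real \<Rightarrow> real" where
  "poly2 Q z y = poly (poly Q [:y:]) z"

lemma poly2_simps [simp]:
  "poly2 0 z y = 0" "poly2 1 z y = 1"
  "poly2 (P + Q) z y = poly2 P z y + poly2 Q z y"
  "poly2 (P * Q) z y = poly2 P z y * poly2 Q z y"
  "poly2 (P - Q) z y = poly2 P z y - poly2 Q z y"
  "poly2 (P ^ k) z y = poly2 P z y ^ k"
  "poly2 (smult c P) z y = poly c z * poly2 P z y"
  "poly2 [:c:] z y = poly c z"
  "poly2 (pCons c P) z y = poly c z + y * poly2 P z y"
  by (simp_all add: poly2_def)

lemma poly2_prod: "poly2 (prod f A) z y = (\<Prod>i\<in>A. poly2 (f i) z y)"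
  by (induction A rule: infinite_finite_induct) auto

definition algebraic_fun :: "(real \<Rightarrow> real) \<Rightarrow> bool" where
  "algebraic_fun \<phi> \<longleftrightarrow> (\<exists>Q. Q \<noteq> 0 \<and> (\<forall>z. poly2 Q z (\<phi> z) = 0))"

text \<open>Substituting \<open>y - (c * z + d)\<close> for \<open>y\<close> is an automorphism of the polynomial ring, so it keeps the
annihilating polynomial nonzero.\<close>

lemma algebraic_fun_add_affine:
  assumes "algebraic_fun \<phi>"
  shows "algebraic_fun (\<lambda>z. \<phi> z + (c * z + d))"
proof -
  obtain Q where Q: "Q \<noteq> 0" "\<And>z. poly2 Q z (\<phi> z) = 0"
    using assms by (auto simp: algebraic_fun_def)
  define S :: "real poly poly" where "S = [:- [:d, c:], 1:]"
  have "pcompose Q S \<noteq> 0"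
    using Q(1) by (subst pcompose_eq_0_iff) (auto simp: S_def)
  moreover have "poly2 (pcompose Q S) z (\<phi> z + (c * z + d)) = 0" for z
  proof -
    have "poly2 (pcompose Q S) z y = poly2 Q z (y - (c * z + d))" for y
    proof (induction Q)
      case (pCons q Q)
      then show ?case
        by (simp add: pcompose_pCons S_def algebra_simps)
    qed simp
    then show ?thesis using Q(2) by simp
  qed
  ultimately show ?thesis unfolding algebraic_fun_def by blast
qed

lemma real_polynomial_function_poly2:
  fixes P :: "real \<times> real \<Rightarrow> real"
  assumes "real_polynomial_function P"
  shows "\<exists>Q. \<forall>z y. P (z, y) = poly2 Q z y"
  using assms
proof (induction rule: real_polynomial_function.induct)
  case (linear f)
  then interpret bounded_linear f .
  have "f (z, y) = poly2 [:[:0, f (1, 0):], [:f (0, 1):]:] z y" for z y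
  proof -
    have "f (z, y) = f (z *\<^sub>R (1, 0) + y *\<^sub>R (0, 1))" by simp
    also have "\<dots> = z * f (1, 0) + y * f (0, 1)" by (simp only: add scaleR) simp
    finally show ?thesis by simp
  qed
  then show ?case by blast
next
  case (const c)
  have "c = poly2 [:[:c:]:] z y" for z y by simp
  then show ?case by blast
next
  case (add f g)
  then show ?case by (metis poly2_simps(3))
next
  case (mult f g)
  then show ?case by (metis poly2_simps(4))
qed

text \<open>The annihilating polynomial is the product of all nonzero polynomials that occur in the
semialgebraic description of the graph. It vanishes at a graph point because the cell of that
point lies inside the graph and hence has no interior: either a nontrivial equation holds there
or a nontrivial inequality is tight.\<close>

lemma semialgebraic_imp_algebraic_fun:
  fixes \<phi> :: "real \<Rightarrow> real"
  assumes "semialgebraic_function \<phi>"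
  shows "algebraic_fun \<phi>"
proof -
  obtain k l :: nat and g h :: "nat \<Rightarrow> nat \<Rightarrow> real \<times> real \<Rightarrow> real" where
    gh: "\<And>i j. i < l \<Longrightarrow> j < k \<Longrightarrow> real_polynomial_function (g i j) \<and> real_polynomial_function (h i j)"
    and graph: "{(x, \<phi> x) | x. True} = (\<Union>j<k. \<Inter>i<l. {u. g i j u = 0 \<and> h i j u \<le> 0})"
    using assms unfolding semialgebraic_function_def semialgebraic_def by (elim exE conjE) (rule that, auto)
  have "\<forall>i j. \<exists>Q. i < l \<and> j < k \<longrightarrow> (\<forall>z y. g i j (z, y) = poly2 Q z y)"
    using gh real_polynomial_function_poly2 by blast
  then obtain G where G: "\<And>i j z y. i < l \<Longrightarrow> j < k \<Longrightarrow> g i j (z, y) = poly2 (G i j) z y"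
    by metis
  have "\<forall>i j. \<exists>Q. i < l \<and> j < k \<longrightarrow> (\<forall>z y. h i j (z, y) = poly2 Q z y)"
    using gh real_polynomial_function_poly2 by blast
  then obtain H where H: "\<And>i j z y. i < l \<Longrightarrow> j < k \<Longrightarrow> h i j (z, y) = poly2 (H i j) z y"
    by metis
  define one_if_zero :: "real poly poly \<Rightarrow> real poly poly"
    where "one_if_zero P = (if P = 0 then 1 else P)" for P
  define Q where "Q = (\<Prod>(i, j)\<in>{..<l} \<times> {..<k}. one_if_zero (G i j) * one_if_zero (H i j))"
  have "Q \<noteq> 0"
    by (auto simp: Q_def one_if_zero_def)
  moreover have "poly2 Q z (\<phi> z) = 0" for z
  proof -
    have "(z, \<phi> z) \<in> (\<Union>j<k. \<Inter>i<l. {u. g i j u = 0 \<and> h i j u \<le> 0})"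
      using graph by blast
    then obtain j where j: "j < k" and
      cell: "\<And>i. i < l \<Longrightarrow> g i j (z, \<phi> z) = 0 \<and> h i j (z, \<phi> z) \<le> 0"
      by auto
    have "\<exists>i<l. (G i j \<noteq> 0 \<and> poly2 (G i j) z (\<phi> z) = 0) \<or> (H i j \<noteq> 0 \<and> poly2 (H i j) z (\<phi> z) = 0)"
    proof (rule ccontr)
      assume neg: "\<not> ?thesis"
      have G0: "G i j = 0" if "i < l" for i
        using neg conjunct1[OF cell[OF that]] G[OF that j, of z "\<phi> z"] that by metis
      \<comment> \<open>No equation and no binding inequality is left, so the cell contains a piece of the
        vertical line through the point.\<close>
      have "eventually (\<lambda>y. h i j (z, y) \<le> 0) (at (\<phi> z))" if i: "i < l" for i
      proof (cases "H i j = 0")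
        case True
        then show ?thesis using H[OF i j] by simp
      next
        case False
        then have "h i j (z, \<phi> z) \<noteq> 0"
          using neg H[OF i j, of z "\<phi> z"] i by metis
        then have "h i j (z, \<phi> z) < 0"
          using conjunct2[OF cell[OF i]] by linarith
        moreover have "((\<lambda>y. h i j (z, y)) \<longlongrightarrow> h i j (z, \<phi> z)) (at (\<phi> z))"
        proof -
          have "continuous_on UNIV (h i j)"
            using gh[OF i j] by (auto intro!: continuous_at_imp_continuous_on
                continuous_real_polymonial_function)
          then have "continuous_on UNIV (\<lambda>y. h i j (z, y))"
            by (auto intro!: continuous_on_compose2[of UNIV "h i j"] continuous_intros)
          then show ?thesis by (simp add: continuous_on_def)
        qed
        ultimately have "eventually (\<lambda>y. h i j (z, y) < 0) (at (\<phi> z))"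
          by (simp add: order_tendstoD(2))
        then show ?thesis by (rule eventually_mono) simp
      qed
      then have "eventually (\<lambda>y. \<forall>i\<in>{..<l}. h i j (z, y) \<le> 0) (at (\<phi> z))"
        by (intro eventually_ball_finite) auto
      moreover have "eventually (\<lambda>y. y \<noteq> \<phi> z) (at (\<phi> z))"
        by (simp add: eventually_at_filter)
      ultimately have "eventually (\<lambda>y. (\<forall>i\<in>{..<l}. h i j (z, y) \<le> 0) \<and> y \<noteq> \<phi> z) (at (\<phi> z))"
        by eventually_elim simp
      then obtain y where y: "\<forall>i\<in>{..<l}. h i j (z, y) \<le> 0" "y \<noteq> \<phi> z"
        using eventually_happens by fastforce
      have "g i j (z, y) = 0 \<and> h i j (z, y) \<le> 0" if "i < l" for i
        using y(1) that G[OF that j, of z y] G0[OF that] by simp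
      then have "(z, y) \<in> (\<Union>j<k. \<Inter>i<l. {u. g i j u = 0 \<and> h i j u \<le> 0})"
        using j by blast
      then have "(z, y) \<in> {(x, \<phi> x) | x. True}"
        using graph by simp
      then show False using y(2) by auto
    qed
    then obtain i where "i < l" and
      "(G i j \<noteq> 0 \<and> poly2 (G i j) z (\<phi> z) = 0) \<or> (H i j \<noteq> 0 \<and> poly2 (H i j) z (\<phi> z) = 0)"
      by blast
    then show ?thesis
      using j unfolding Q_def poly2_prod
      by (intro prod_zero bexI[of _ "(i, j)"]) (auto simp: one_if_zero_def)
  qed
  ultimately show ?thesis unfolding algebraic_fun_def by blast
qed

text \<open>Dividing \<open>Q(z, y)\<close> by the highest possible power of \<open>y\<close> leaves a polynomial whose part \<open>q(z)\<close> without \<open>y\<close> is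
nonzero. Where \<open>\<psi> z \<noteq> 0\<close> the quotient still vanishes at \<open>(z, \<psi> z)\<close>, so that \<open>q(z)\<close> equals \<open>\<psi> z\<close>
times a bounded factor. Locally \<open>\<bar>q\<bar>\<close> behaves like a power of the distance to a root, and this is
the source of all exponents below.\<close>

lemma algebraic_fun_lower_bound:
  assumes "algebraic_fun \<psi>" and bdd: "\<And>z. \<bar>z\<bar> \<le> B \<Longrightarrow> 0 \<le> \<psi> z \<and> \<psi> z \<le> M"
  obtains q C where "q \<noteq> (0::real poly)" "C > 0"
    "\<And>z. \<bar>z\<bar> \<le> B \<Longrightarrow> \<psi> z \<noteq> 0 \<Longrightarrow> \<bar>poly q z\<bar> \<le> C * \<psi> z"
proof -
  obtain Q where Q: "Q \<noteq> 0" "\<And>z. poly2 Q z (\<psi> z) = 0"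
    using assms by (auto simp: algebraic_fun_def)
  have "\<exists>q P. q \<noteq> 0 \<and> (\<forall>z. \<psi> z \<noteq> 0 \<longrightarrow> poly q z = - \<psi> z * poly2 P z (\<psi> z))"
    if "Q \<noteq> 0" "\<And>z. \<psi> z \<noteq> 0 \<Longrightarrow> poly2 Q z (\<psi> z) = 0" for Q
    using that
  proof (induction Q)
    case (pCons q Q)
    show ?case
    proof (cases "q = 0")
      case True
      then have "poly2 Q z (\<psi> z) = 0" if "\<psi> z \<noteq> 0" for z
        using pCons.prems(2)[OF that] that by simp
      then show ?thesis using pCons.IH pCons.prems(1) True by auto
    next
      case False
      have "poly q z = - \<psi> z * poly2 Q z (\<psi> z)" if "\<psi> z \<noteq> 0" for z
        using pCons.prems(2)[OF that] by simp
      then show ?thesis using False by blast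
    qed
  qed simp
  then obtain q P where q: "q \<noteq> 0" "\<And>z. \<psi> z \<noteq> 0 \<Longrightarrow> poly q z = - \<psi> z * poly2 P z (\<psi> z)"
    using Q by blast
  have "\<exists>C>0. \<forall>z y. \<bar>z\<bar> \<le> B \<longrightarrow> 0 \<le> y \<and> y \<le> M \<longrightarrow> \<bar>poly2 P z y\<bar> \<le> C"
  proof -
    have "continuous_on UNIV (\<lambda>u. poly2 P (fst u) (snd u))"
    proof (induction P)
      case (pCons p P)
      then show ?case by (simp, intro continuous_intros)
    qed simp
    then have "compact ((\<lambda>u. poly2 P (fst u) (snd u)) ` ({-B..B} \<times> {0..M}))"
      by (intro compact_continuous_image compact_Times) (auto intro: continuous_on_subset)
    then obtain C where "C > 0" "\<forall>x\<in>(\<lambda>u. poly2 P (fst u) (snd u)) ` ({-B..B} \<times> {0..M}). norm x \<le> C"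
      using compact_imp_bounded bounded_pos by blast
    then show ?thesis by (intro exI[of _ C]) (auto simp: abs_le_iff)
  qed
  then obtain C where C: "C > 0" "\<And>z y. \<bar>z\<bar> \<le> B \<Longrightarrow> 0 \<le> y \<and> y \<le> M \<Longrightarrow> \<bar>poly2 P z y\<bar> \<le> C"
    by blast
  have "\<bar>poly q z\<bar> \<le> C * \<psi> z" if "\<bar>z\<bar> \<le> B" "\<psi> z \<noteq> 0" for z
  proof -
    have "\<bar>poly q z\<bar> = \<psi> z * \<bar>poly2 P z (\<psi> z)\<bar>"
      using q(2)[OF that(2)] bdd[OF that(1)] by (simp add: abs_mult)
    also have "\<dots> \<le> \<psi> z * C"
      using C(2)[OF that(1)] bdd[OF that(1)] by (intro mult_left_mono) auto
    finally show ?thesis by (simp add: mult.commute)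
  qed
  then show ?thesis using that q(1) C(1) by blast
qed

section \<open>Hoffman's bound for polyhedra\<close>

definition halfspaces_inter :: "('a::euclidean_space \<times> real) set \<Rightarrow> 'a set" where
  "halfspaces_inter A = {x. \<forall>(a, b)\<in>A. a \<bullet> x \<le> b}"

lemma closed_halfspaces_inter: "closed (halfspaces_inter A)"
proof -
  have "halfspaces_inter A = (\<Inter>(a, b)\<in>A. {x. a \<bullet> x \<le> b})"
    by (auto simp: halfspaces_inter_def)
  then show ?thesis by (auto intro!: closed_INT closed_halfspace_le)
qed

lemma convex_halfspaces_inter: "convex (halfspaces_inter A)"
proof -
  have "halfspaces_inter A = (\<Inter>(a, b)\<in>A. {x. a \<bullet> x \<le> b})"
    by (auto simp: halfspaces_inter_def)
  then show ?thesis by (auto intro!: convex_INT convex_halfspace_le)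
qed

text \<open>A vector of the polar cone of \<open>{d. \<forall>(a, b)\<in>I. a \<bullet> d \<le> 0}\<close> that also lies in that cone
satisfies \<open>v \<bullet> v \<le> 0\<close>. So every unit vector of the polar violates some constraint, and
compactness makes the violation uniform. This replaces the usual appeal to Farkas' lemma.\<close>

lemma violation_on_polar:
  fixes I :: "('a::euclidean_space \<times> real) set"
  assumes "finite I"
  shows "\<exists>m>0. \<forall>v. (\<forall>d. (\<forall>(a, b)\<in>I. a \<bullet> d \<le> 0) \<longrightarrow> v \<bullet> d \<le> 0) \<longrightarrow>
           m * norm v \<le> (\<Sum>(a, b)\<in>I. max 0 (a \<bullet> v))"
proof -
  define polar where "polar = {v. \<forall>d. (\<forall>(a, b)\<in>I. a \<bullet> d \<le> 0) \<longrightarrow> v \<bullet> d \<le> 0}"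
  define \<phi> where "\<phi> v = (\<Sum>(a, b)\<in>I. max 0 (a \<bullet> v))" for v
  have polar_eq: "polar = (\<Inter>d\<in>{d. \<forall>(a, b)\<in>I. a \<bullet> d \<le> 0}. {v. d \<bullet> v \<le> 0})"
    by (auto simp: polar_def inner_commute)
  have "compact (sphere 0 1 \<inter> polar)"
    unfolding polar_eq by (intro compact_Int_closed closed_INT ballI closed_halfspace_le) auto
  moreover have cont: "continuous_on S \<phi>" for S
    unfolding \<phi>_def case_prod_unfold by (intro continuous_intros)
  moreover have pos: "\<phi> v > 0" if "v \<in> sphere 0 1 \<inter> polar" for v
  proof -
    have "\<phi> v \<ge> 0" unfolding \<phi>_def by (intro sum_nonneg) auto
    moreover have "\<phi> v \<noteq> 0"
    proof
      assume "\<phi> v = 0"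
      then have "\<forall>p\<in>I. (case p of (a, b) \<Rightarrow> max 0 (a \<bullet> v)) = 0"
        unfolding \<phi>_def using assms by (subst (asm) sum_nonneg_eq_0_iff) auto
      then have "\<forall>(a, b)\<in>I. a \<bullet> v \<le> 0" by fastforce
      then have "v \<bullet> v \<le> 0" using that unfolding polar_def by blast
      then have "v = 0" by (metis inner_ge_zero inner_eq_zero_iff order_antisym)
      then show False using that by auto
    qed
    ultimately show ?thesis by simp
  qed
  ultimately have "\<exists>m>0. \<forall>v \<in> sphere 0 1 \<inter> polar. m \<le> \<phi> v"
  proof (cases "sphere 0 1 \<inter> polar = {}")
    case True
    then show ?thesis by (intro exI[of _ 1]) auto
  next
    case False
    then obtain u where "u \<in> sphere 0 1 \<inter> polar" "\<forall>v \<in> sphere 0 1 \<inter> polar. \<phi> u \<le> \<phi> v"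
      using continuous_attains_inf[OF \<open>compact (sphere 0 1 \<inter> polar)\<close> False cont] by blast
    then show ?thesis using pos by blast
  qed
  then obtain m where m: "m > 0" "\<And>v. v \<in> sphere 0 1 \<inter> polar \<Longrightarrow> m \<le> \<phi> v" by blast
  have "m * norm v \<le> \<phi> v" if "v \<in> polar" for v
  proof (cases "v = 0")
    case True
    then show ?thesis by (simp add: \<phi>_def)
  next
    case False
    define u where "u = (1 / norm v) *\<^sub>R v"
    have "u \<in> sphere 0 1 \<inter> polar"
      using that False by (auto simp: u_def polar_def divide_le_0_iff)
    then have "norm v * m \<le> norm v * \<phi> u" using m by (intro mult_left_mono) auto
    also have "\<dots> = \<phi> v"
      unfolding \<phi>_def sum_distrib_left
    proof (intro sum.cong refl, clarify)
      fix a b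
      have "norm v * max 0 (a \<bullet> u) = max 0 (norm v * (a \<bullet> u))"
        by (simp add: max_mult_distrib_left)
      also have "norm v * (a \<bullet> u) = a \<bullet> v" using False by (simp add: u_def)
      finally show "norm v * max 0 (a \<bullet> u) = max 0 (a \<bullet> v)" .
    qed
    finally show ?thesis by (simp add: mult.commute)
  qed
  then show ?thesis using m(1) unfolding \<phi>_def polar_def by blast
qed

text \<open>If \<open>y\<close> is the projection of \<open>x\<close> on the polyhedron, then \<open>x - y\<close> lies in the polar of the cone of
feasible directions at \<open>y\<close>, which is cut out by the constraints active at \<open>y\<close>. There are
finitely many active sets, hence one constant serves all \<open>x\<close>.\<close>

theorem hoffman_bound:
  fixes A :: "('a::euclidean_space \<times> real) set"
  assumes "finite A" "halfspaces_inter A \<noteq> {}"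
  shows "\<exists>C>0. \<forall>x. infdist x (halfspaces_inter A) \<le> C * (\<Sum>(a, b)\<in>A. max 0 (a \<bullet> x - b))"
proof -
  let ?P = "halfspaces_inter A"
  have "\<forall>I. \<exists>m. I \<subseteq> A \<longrightarrow> m > 0 \<and> (\<forall>v. (\<forall>d. (\<forall>(a, b)\<in>I. a \<bullet> d \<le> 0) \<longrightarrow> v \<bullet> d \<le> 0) \<longrightarrow>
           m * norm v \<le> (\<Sum>(a, b)\<in>I. max 0 (a \<bullet> v)))"
    using violation_on_polar finite_subset[OF _ assms(1)] by metis
  then obtain m where m: "\<And>I. I \<subseteq> A \<Longrightarrow> m I > 0"
    "\<And>I v. I \<subseteq> A \<Longrightarrow> (\<And>d. (\<forall>(a, b)\<in>I. a \<bullet> d \<le> 0) \<Longrightarrow> v \<bullet> d \<le> 0) \<Longrightarrow>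
           m I * norm v \<le> (\<Sum>(a, b)\<in>I. max 0 (a \<bullet> v))"
    by metis
  define m0 where "m0 = Min (m ` Pow A)"
  have "m0 \<in> m ` Pow A"
    unfolding m0_def using assms(1) by (intro Min_in) auto
  then have m0: "m0 > 0" "\<And>I. I \<subseteq> A \<Longrightarrow> m0 \<le> m I"
    using assms(1) m(1) by (auto simp: m0_def)
  have "infdist x ?P \<le> 1 / m0 * (\<Sum>(a, b)\<in>A. max 0 (a \<bullet> x - b))" for x
  proof -
    define y where "y = closest_point ?P x"
    have y: "y \<in> ?P"
      unfolding y_def using closed_halfspaces_inter assms(2) by (rule closest_point_in_set)
    define I where "I = {(a, b)\<in>A. a \<bullet> y = b}"
    have "I \<subseteq> A" by (auto simp: I_def)
    \<comment> \<open>Small steps along d stay feasible, since inactive constraints have slack.\<close>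
    have polar: "(x - y) \<bullet> d \<le> 0" if d: "\<forall>(a, b)\<in>I. a \<bullet> d \<le> 0" for d
    proof -
      have "eventually (\<lambda>t. \<forall>p\<in>A. fst p \<bullet> (y + t *\<^sub>R d) \<le> snd p) (at_right 0)"
      proof (intro eventually_ball_finite assms(1) ballI)
        fix p assume p: "p \<in> A"
        then have "fst p \<bullet> y \<le> snd p" using y by (auto simp: halfspaces_inter_def)
        show "eventually (\<lambda>t. fst p \<bullet> (y + t *\<^sub>R d) \<le> snd p) (at_right 0)"
        proof (cases "fst p \<bullet> y = snd p")
          case True
          then have "fst p \<bullet> d \<le> 0" using d p by (auto simp: I_def)
          then have "fst p \<bullet> (y + t *\<^sub>R d) \<le> snd p" if "t > 0" for t
            using True that by (simp add: inner_add_right mult_le_0_iff)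
          then show ?thesis by (auto simp: eventually_at_right_field intro!: exI[of _ 1])
        next
          case False
          then have "fst p \<bullet> (y + 0 *\<^sub>R d) < snd p" using \<open>fst p \<bullet> y \<le> snd p\<close> by simp
          moreover have "((\<lambda>t. fst p \<bullet> (y + t *\<^sub>R d)) \<longlongrightarrow> fst p \<bullet> (y + 0 *\<^sub>R d)) (at_right 0)"
            by (intro tendsto_intros)
          ultimately have "eventually (\<lambda>t. fst p \<bullet> (y + t *\<^sub>R d) < snd p) (at_right 0)"
            by (simp add: order_tendstoD(2))
          then show ?thesis by (rule eventually_mono) simp
        qed
      qed
      moreover have "eventually (\<lambda>t::real. t > 0) (at_right 0)"
        by (simp add: eventually_at_right_less)
      ultimately have "eventually (\<lambda>t. (\<forall>p\<in>A. fst p \<bullet> (y + t *\<^sub>R d) \<le> snd p) \<and> t > 0) (at_right 0)"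
        by eventually_elim simp
      then obtain t where t: "t > 0" "\<forall>p\<in>A. fst p \<bullet> (y + t *\<^sub>R d) \<le> snd p"
        using eventually_happens[of _ "at_right (0::real)"] by auto
      then have "y + t *\<^sub>R d \<in> ?P" by (auto simp: halfspaces_inter_def)
      then have "(x - y) \<bullet> (y + t *\<^sub>R d - y) \<le> 0"
        unfolding y_def by (intro closest_point_dot convex_halfspaces_inter closed_halfspaces_inter)
      then show ?thesis using t(1) by (simp add: mult_le_0_iff)
    qed
    have "m0 * norm (x - y) \<le> m I * norm (x - y)"
      using m0 \<open>I \<subseteq> A\<close> by (intro mult_right_mono) auto
    also have "\<dots> \<le> (\<Sum>(a, b)\<in>I. max 0 (a \<bullet> (x - y)))"
      using m(2)[OF \<open>I \<subseteq> A\<close> polar] by blast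
    also have "\<dots> = (\<Sum>(a, b)\<in>I. max 0 (a \<bullet> x - b))"
      by (intro sum.cong) (auto simp: I_def inner_diff_right)
    also have "\<dots> \<le> (\<Sum>(a, b)\<in>A. max 0 (a \<bullet> x - b))"
      using assms(1) \<open>I \<subseteq> A\<close> by (intro sum_mono2) auto
    finally have "norm (x - y) \<le> 1 / m0 * (\<Sum>(a, b)\<in>A. max 0 (a \<bullet> x - b))"
      using m0(1) by (simp add: field_simps)
    moreover have "infdist x ?P \<le> norm (x - y)"
      using infdist_le[OF y, of x] by (simp add: dist_norm)
    ultimately show ?thesis by linarith
  qed
  then show ?thesis using m0(1) by (intro exI[of _ "1 / m0"]) auto
qed

section \<open>Polyhedral error bounds\<close>

text \<open>Exponent and constant may depend on the halfspace and on the radius; nothing uniform is asked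
for, so that bounds for different summands can be pooled without comparing exponents.\<close>

definition violation_bounded :: "('a::euclidean_space \<Rightarrow> real) \<Rightarrow> 'a \<times> real \<Rightarrow> bool" where
  "violation_bounded \<Psi> p \<longleftrightarrow>
     (\<forall>B. \<exists>k\<ge>1. \<exists>c>0. \<forall>x. norm x \<le> B \<longrightarrow> max 0 (fst p \<bullet> x - snd p) ^ k \<le> c * \<Psi> x)"

text \<open>The zero set of \<open>\<Psi>\<close> is a polyhedron, and \<open>\<Psi>\<close> controls a power of the violation of each of its
constraints. Asking for the violation of constraints instead of the distance to the zero set
makes the property additive: the zero set of a sum is the intersection of the zero sets, and
the distance to an intersection is not controlled by the distances to its parts without further
information. Hoffman's bound converts back at the very end.\<close>

definition polyhedral_error_bound :: "('a::euclidean_space \<Rightarrow> real) \<Rightarrow> bool" where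
  "polyhedral_error_bound \<Psi> \<longleftrightarrow>
     (\<forall>x. 0 \<le> \<Psi> x) \<and>
     (\<exists>A. finite A \<and> (\<forall>x\<in>halfspaces_inter A. \<Psi> x \<le> 0) \<and> (\<forall>p\<in>A. violation_bounded \<Psi> p))"

lemma violation_bounded_mono:
  assumes "violation_bounded \<Psi> p" "K > 0" "\<And>x. \<Psi> x \<le> K * \<Psi>' x"
  shows "violation_bounded \<Psi>' p"
  unfolding violation_bounded_def
proof
  fix B
  obtain k c where kc: "k \<ge> 1" "c > 0"
    "\<And>x. norm x \<le> B \<Longrightarrow> max 0 (fst p \<bullet> x - snd p) ^ k \<le> c * \<Psi> x"
    using assms(1) unfolding violation_bounded_def by blast
  have "c * \<Psi> x \<le> (c * K) * \<Psi>' x" for x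
    using mult_left_mono[OF assms(3), of c x] kc(2) by (simp add: mult.assoc)
  then have "\<forall>x. norm x \<le> B \<longrightarrow> max 0 (fst p \<bullet> x - snd p) ^ k \<le> (c * K) * \<Psi>' x"
    using kc(3) order_trans by blast
  then show "\<exists>k\<ge>1. \<exists>c>0. \<forall>x. norm x \<le> B \<longrightarrow> max 0 (fst p \<bullet> x - snd p) ^ k \<le> c * \<Psi>' x"
    using kc(1,2) assms(2) by (intro exI[of _ k] conjI exI[of _ "c * K"]) auto
qed

lemma polyhedral_error_bound_cmult:
  assumes "polyhedral_error_bound \<Psi>" "c > 0"
  shows "polyhedral_error_bound (\<lambda>x. c * \<Psi> x)"
proof -
  obtain A where A: "finite A" "\<forall>x\<in>halfspaces_inter A. \<Psi> x \<le> 0" "\<forall>p\<in>A. violation_bounded \<Psi> p"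
    and nonneg: "\<And>x. 0 \<le> \<Psi> x"
    using assms(1) unfolding polyhedral_error_bound_def by blast
  have "\<forall>p\<in>A. violation_bounded (\<lambda>x. c * \<Psi> x) p"
  proof
    fix p assume "p \<in> A"
    then have "violation_bounded \<Psi> p" using A(3) by blast
    then show "violation_bounded (\<lambda>x. c * \<Psi> x) p"
      by (rule violation_bounded_mono[of _ _ "1 / c"]) (use assms(2) in auto)
  qed
  then show ?thesis
    using A(1,2) assms(2) nonneg unfolding polyhedral_error_bound_def
    by (auto intro!: exI[of _ A] simp: mult_le_0_iff)
qed

lemma polyhedral_error_bound_sum:
  assumes "finite I" "\<And>i. i \<in> I \<Longrightarrow> polyhedral_error_bound (\<Psi> i)"
  shows "polyhedral_error_bound (\<lambda>x. \<Sum>i\<in>I. \<Psi> i x)"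
proof -
  have nonneg: "0 \<le> \<Psi> i x" if "i \<in> I" for i x
    using assms(2)[OF that] by (auto simp: polyhedral_error_bound_def)
  have "\<forall>i. \<exists>A. i \<in> I \<longrightarrow> finite A \<and> (\<forall>x\<in>halfspaces_inter A. \<Psi> i x \<le> 0) \<and> (\<forall>p\<in>A. violation_bounded (\<Psi> i) p)"
    using assms(2) unfolding polyhedral_error_bound_def by blast
  then obtain A where "\<forall>i. i \<in> I \<longrightarrow> finite (A i) \<and> (\<forall>x\<in>halfspaces_inter (A i). \<Psi> i x \<le> 0) \<and>
      (\<forall>p\<in>A i. violation_bounded (\<Psi> i) p)"
    by (elim choice[THEN exE])
  then have A: "\<And>i. i \<in> I \<Longrightarrow> finite (A i)"
    "\<And>i x. i \<in> I \<Longrightarrow> x \<in> halfspaces_inter (A i) \<Longrightarrow> \<Psi> i x \<le> 0"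
    "\<And>i p. i \<in> I \<Longrightarrow> p \<in> A i \<Longrightarrow> violation_bounded (\<Psi> i) p"
    by blast+
  have "violation_bounded (\<lambda>x. \<Sum>i\<in>I. \<Psi> i x) p" if p: "p \<in> (\<Union>i\<in>I. A i)" for p
  proof -
    obtain i where i: "i \<in> I" "p \<in> A i" using p by blast
    have "\<Psi> i x \<le> 1 * (\<Sum>i\<in>I. \<Psi> i x)" for x
      using member_le_sum[of i I "\<lambda>i. \<Psi> i x"] i(1) nonneg assms(1) by auto
    then show ?thesis using violation_bounded_mono[OF A(3)[OF i], of 1] by auto
  qed
  moreover have "(\<Sum>i\<in>I. \<Psi> i x) \<le> 0" if "x \<in> halfspaces_inter (\<Union>i\<in>I. A i)" for x
    using that by (intro sum_nonpos A(2)) (auto simp: halfspaces_inter_def)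
  ultimately show ?thesis
    unfolding polyhedral_error_bound_def using assms(1) A(1) nonneg
    by (intro conjI exI[of _ "\<Union>i\<in>I. A i"] allI sum_nonneg) auto
qed

lemma polyhedral_error_bound_add:
  assumes "polyhedral_error_bound \<Psi>" "polyhedral_error_bound \<Psi>'"
  shows "polyhedral_error_bound (\<lambda>x. \<Psi> x + \<Psi>' x)"
  using polyhedral_error_bound_sum[of "UNIV :: bool set" "\<lambda>i. if i then \<Psi> else \<Psi>'"] assms
  by (simp add: UNIV_bool add.commute)

lemma polyhedral_error_bound_linear:
  fixes T :: "'a::euclidean_space \<Rightarrow> 'b::euclidean_space"
  assumes "polyhedral_error_bound \<Psi>" "linear T"
  shows "polyhedral_error_bound (\<lambda>x. \<Psi> (T x))"
proof -
  obtain A where A: "finite A" "\<forall>x\<in>halfspaces_inter A. \<Psi> x \<le> 0" "\<forall>p\<in>A. violation_bounded \<Psi> p"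
    and nonneg: "\<And>x. 0 \<le> \<Psi> x"
    using assms(1) unfolding polyhedral_error_bound_def by blast
  define A' where "A' = (\<lambda>(a, b). (adjoint T a, b)) ` A"
  have adj: "adjoint T a \<bullet> x = a \<bullet> T x" for a x
    using adjoint_works[OF assms(2), of x a] by (simp add: inner_commute)
  have "violation_bounded (\<lambda>x. \<Psi> (T x)) (adjoint T (fst p), snd p)" if p: "p \<in> A" for p
    unfolding violation_bounded_def
  proof
    fix B
    obtain D where D: "D > 0" "\<And>x. norm (T x) \<le> D * norm x"
      using linear_bounded_pos[OF assms(2)] by blast
    obtain k c where kc: "k \<ge> 1" "c > 0"
      "\<And>x. norm x \<le> D * B \<Longrightarrow> max 0 (fst p \<bullet> x - snd p) ^ k \<le> c * \<Psi> x"
      using A(3) p unfolding violation_bounded_def by blast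
    have "norm (T x) \<le> D * B" if "norm x \<le> B" for x
      using D(2)[of x] mult_left_mono[OF that, of D] D(1) by linarith
    then show "\<exists>k\<ge>1. \<exists>c>0. \<forall>x. norm x \<le> B \<longrightarrow>
        max 0 (fst (adjoint T (fst p), snd p) \<bullet> x - snd (adjoint T (fst p), snd p)) ^ k \<le> c * \<Psi> (T x)"
      using kc by (intro exI[of _ k] conjI exI[of _ c]) (auto simp: adj)
  qed
  then have "\<forall>p\<in>A'. violation_bounded (\<lambda>x. \<Psi> (T x)) p"
    by (auto simp: A'_def)
  moreover have "\<Psi> (T x) \<le> 0" if "x \<in> halfspaces_inter A'" for x
  proof -
    have "T x \<in> halfspaces_inter A"
      using that by (auto simp: halfspaces_inter_def A'_def adj)
    then show ?thesis using A(2) by blast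
  qed
  ultimately show ?thesis
    unfolding polyhedral_error_bound_def using A(1) nonneg
    by (intro conjI exI[of _ A']) (auto simp: A'_def)
qed

text \<open>The case of an isolated zero at the origin: the polyhedron \<open>{0}\<close> is described by the constraints
\<open>\<plusminus>e \<bullet> x \<le> 0\<close> for the basis vectors \<open>e\<close>.\<close>

lemma polyhedral_error_bound_point:
  fixes \<Psi> :: "'a::euclidean_space \<Rightarrow> real"
  assumes "k \<ge> 1" "m > 0" "\<And>x. m * norm x ^ k \<le> \<Psi> x" "\<Psi> 0 = 0"
  shows "polyhedral_error_bound \<Psi>"
proof -
  define A :: "('a \<times> real) set" where "A = (\<lambda>e. (e, 0)) ` (Basis \<union> uminus ` Basis)"
  have "violation_bounded \<Psi> (e, 0)" if "norm e = 1" for e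
    unfolding violation_bounded_def
  proof
    fix B
    have "max 0 (e \<bullet> x) ^ k \<le> 1 / m * \<Psi> x" for x
    proof -
      have "max 0 (e \<bullet> x) \<le> norm x"
        using norm_cauchy_schwarz[of e x] that by auto
      then have "max 0 (e \<bullet> x) ^ k \<le> norm x ^ k"
        by (intro power_mono) auto
      also have "\<dots> \<le> 1 / m * \<Psi> x"
        using assms(3)[of x] assms(2) by (simp add: field_simps)
      finally show ?thesis .
    qed
    then show "\<exists>k\<ge>1. \<exists>c>0. \<forall>x. norm x \<le> B \<longrightarrow> max 0 (fst (e, 0::real) \<bullet> x - snd (e, 0::real)) ^ k \<le> c * \<Psi> x"
      using assms(1,2) by (intro exI[of _ k] conjI exI[of _ "1 / m"]) auto
  qed
  then have "\<forall>p\<in>A. violation_bounded \<Psi> p" by (auto simp: A_def)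
  moreover have "\<Psi> x \<le> 0" if "x \<in> halfspaces_inter A" for x
  proof -
    have "x \<bullet> e = 0" if "e \<in> Basis" for e
    proof -
      have "(e, 0) \<in> A" "(- e, 0) \<in> A" using that by (auto simp: A_def)
      then have "e \<bullet> x \<le> 0" "- e \<bullet> x \<le> 0"
        using \<open>x \<in> halfspaces_inter A\<close> unfolding halfspaces_inter_def by blast+
      then show ?thesis by (simp add: inner_commute)
    qed
    then have "x = 0" using euclidean_all_zero_iff by blast
    then show ?thesis using assms(4) by simp
  qed
  moreover have "0 \<le> \<Psi> x" for x
    using assms(3)[of x] assms(2) by (meson mult_nonneg_nonneg norm_ge_zero zero_le_power less_imp_le order_trans)
  ultimately show ?thesis
    unfolding polyhedral_error_bound_def by (intro conjI exI[of _ A]) (auto simp: A_def)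
qed

text \<open>On a sublevel set of \<open>\<Psi>\<close> a smaller exponent only costs a constant, so finitely many exponents
\<open>1 / k\<close> can be replaced by the least of them.\<close>

lemma violation_holder:
  assumes "finite A" "\<And>p. p \<in> A \<Longrightarrow> violation_bounded \<Psi> p" "\<And>x. 0 \<le> \<Psi> x" "\<xi> > 0"
  shows "\<exists>\<theta> c. 0 < \<theta> \<and> \<theta> \<le> 1 \<and> c > 0 \<and>
    (\<forall>x. norm x \<le> B \<longrightarrow> \<Psi> x \<le> \<xi> \<longrightarrow> (\<Sum>p\<in>A. max 0 (fst p \<bullet> x - snd p)) \<le> c * \<Psi> x powr \<theta>)"
  using assms(1,2)
proof (induction A)
  case empty
  show ?case by (intro exI[of _ 1] conjI allI impI) auto
next
  case (insert p A)
  obtain \<theta> c where 1: "0 < \<theta>" "\<theta> \<le> 1" "c > 0"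
    "\<And>x. norm x \<le> B \<Longrightarrow> \<Psi> x \<le> \<xi> \<Longrightarrow> (\<Sum>p\<in>A. max 0 (fst p \<bullet> x - snd p)) \<le> c * \<Psi> x powr \<theta>"
    using insert by blast
  obtain k c' where kc: "k \<ge> 1" "c' > 0"
    "\<And>x. norm x \<le> B \<Longrightarrow> max 0 (fst p \<bullet> x - snd p) ^ k \<le> c' * \<Psi> x"
    using insert.prems[of p] unfolding violation_bounded_def by blast
  have 2: "max 0 (fst p \<bullet> x - snd p) \<le> c' powr (1 / k) * \<Psi> x powr (1 / k)" if "norm x \<le> B" for x
  proof -
    have "max 0 (fst p \<bullet> x - snd p) = (max 0 (fst p \<bullet> x - snd p) ^ k) powr (1 / k)"
      using kc(1) by (subst powr_realpow'[symmetric]) (auto simp: powr_powr)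
    also have "\<dots> \<le> (c' * \<Psi> x) powr (1 / k)"
      using kc(3)[OF that] by (intro powr_mono2) auto
    also have "\<dots> = c' powr (1 / k) * \<Psi> x powr (1 / k)"
      using kc(2) assms(3) by (simp add: powr_mult)
    finally show ?thesis .
  qed
  define \<theta>' where "\<theta>' = min \<theta> (1 / k)"
  have \<theta>': "0 < \<theta>'" "\<theta>' \<le> 1" using 1 kc(1) by (auto simp: \<theta>'_def)
  have 3: "\<Psi> x powr t \<le> \<xi> powr (t - \<theta>') * \<Psi> x powr \<theta>'" if "\<theta>' \<le> t" "\<Psi> x \<le> \<xi>" for t x
  proof -
    have "\<Psi> x powr t = \<Psi> x powr (t - \<theta>') * \<Psi> x powr \<theta>'"
      by (simp flip: powr_add)
    also have "\<dots> \<le> \<xi> powr (t - \<theta>') * \<Psi> x powr \<theta>'"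
      using that assms(3) by (intro mult_right_mono powr_mono2) auto
    finally show ?thesis .
  qed
  define C where "C = c' powr (1 / k) * \<xi> powr (1 / k - \<theta>') + c * \<xi> powr (\<theta> - \<theta>')"
  have "(\<Sum>p\<in>insert p A. max 0 (fst p \<bullet> x - snd p)) \<le> C * \<Psi> x powr \<theta>'"
    if x: "norm x \<le> B" "\<Psi> x \<le> \<xi>" for x
  proof -
    have "(\<Sum>p\<in>insert p A. max 0 (fst p \<bullet> x - snd p))
        \<le> c' powr (1 / k) * \<Psi> x powr (1 / k) + c * \<Psi> x powr \<theta>"
      unfolding sum.insert[OF insert.hyps] by (intro add_mono 1(4)[OF x] 2[OF x(1)])
    also have "\<dots> \<le> c' powr (1 / k) * (\<xi> powr (1 / k - \<theta>') * \<Psi> x powr \<theta>')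
        + c * (\<xi> powr (\<theta> - \<theta>') * \<Psi> x powr \<theta>')"
      using 1(3) x(2) by (intro add_mono mult_left_mono 3) (auto simp: \<theta>'_def)
    finally show ?thesis by (simp add: C_def algebra_simps)
  qed
  moreover have "C > 0"
    using 1(3) kc(2) assms(4) unfolding C_def by (intro add_pos_pos mult_pos_pos) auto
  ultimately show ?case using \<theta>' by blast
qed

lemma min_value_eq: "x \<in> minimizers F \<Longrightarrow> min_value F = F x"
  unfolding min_value_def minimizers_def by (intro cInf_eq_minimum) auto

theorem HEB_on_polyhedral:
  assumes min: "x0 \<in> minimizers F" and peb: "polyhedral_error_bound (\<lambda>x. F x - F x0)"
    and bdd: "bounded (sublevel F \<xi>)" and "\<xi> > 0"
  shows "\<exists>\<theta>. 0 < \<theta> \<and> \<theta> \<le> 1 \<and> HEB_on F \<theta> (sublevel F \<xi>)"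
proof -
  obtain B where B: "\<And>x. x \<in> sublevel F \<xi> \<Longrightarrow> norm x \<le> B"
    using bdd by (auto simp: bounded_iff)
  obtain A where A: "finite A" "\<And>x. x \<in> halfspaces_inter A \<Longrightarrow> F x - F x0 \<le> 0"
    "\<And>p. p \<in> A \<Longrightarrow> violation_bounded (\<lambda>x. F x - F x0) p"
    using peb unfolding polyhedral_error_bound_def by blast
  have nonneg: "0 \<le> F x - F x0" for x
    using min by (auto simp: minimizers_def)
  have sub: "halfspaces_inter A \<subseteq> minimizers F"
  proof
    fix x assume "x \<in> halfspaces_inter A"
    then have "F x \<le> F x0" using A(2) by fastforce
    then show "x \<in> minimizers F" using min unfolding minimizers_def by (auto intro: order_trans)
  qed
  \<comment> \<open>The gap vanishes at x0, so x0 satisfies all constraints and the polyhedron is nonempty.\<close>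
  have "fst p \<bullet> x0 - snd p \<le> 0" if p: "p \<in> A" for p
  proof -
    obtain k c where "k \<ge> 1" "max 0 (fst p \<bullet> x0 - snd p) ^ k \<le> c * (F x0 - F x0)"
      using A(3)[OF p] unfolding violation_bounded_def by blast
    then have "max 0 (fst p \<bullet> x0 - snd p) ^ k \<le> 0" by simp
    then have "max 0 (fst p \<bullet> x0 - snd p) ^ k = 0"
      by (intro antisym) auto
    then show ?thesis by auto
  qed
  then have x0: "x0 \<in> halfspaces_inter A"
    by (force simp: halfspaces_inter_def)
  then obtain C where C: "C > 0"
    "\<And>x. infdist x (halfspaces_inter A) \<le> C * (\<Sum>(a, b)\<in>A. max 0 (a \<bullet> x - b))"
    using hoffman_bound[OF A(1)] by blast
  obtain \<theta> c where \<theta>: "0 < \<theta>" "\<theta> \<le> 1" "c > 0" and holder: "\<And>x. norm x \<le> B \<Longrightarrow> F x - F x0 \<le> \<xi> \<Longrightarrow>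
      (\<Sum>p\<in>A. max 0 (fst p \<bullet> x - snd p)) \<le> c * (F x - F x0) powr \<theta>"
    using violation_holder[OF A(1,3) nonneg \<open>\<xi> > 0\<close>, of B] by blast
  have "infdist x (minimizers F) \<le> (C * c) * (F x - min_value F) powr \<theta>" if x: "x \<in> sublevel F \<xi>" for x
  proof -
    have "infdist x (minimizers F) \<le> infdist x (halfspaces_inter A)"
      using x0 sub by (intro infdist_mono) auto
    also have "\<dots> \<le> C * (\<Sum>p\<in>A. max 0 (fst p \<bullet> x - snd p))"
      using C(2)[of x] by (simp add: case_prod_unfold)
    also have "\<dots> \<le> C * (c * (F x - F x0) powr \<theta>)"
      using B[OF x] x C(1) min_value_eq[OF min]
      by (intro mult_left_mono holder) (auto simp: sublevel_def)
    finally show ?thesis using min_value_eq[OF min] by (simp add: mult.assoc)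
  qed
  moreover have "C * c > 0" using C(1) \<theta>(3) by simp
  ultimately have "HEB_on F \<theta> (sublevel F \<xi>)"
    unfolding HEB_on_def using min by blast
  then show ?thesis using \<theta> by blast
qed

section \<open>Gaps of convex functions above their supporting affine functions\<close>

text \<open>The Bregman distance, with the slope \<open>w\<close> as a parameter because the regularizers are not
differentiable.\<close>

definition bregman :: "('a::real_inner \<Rightarrow> real) \<Rightarrow> 'a \<Rightarrow> 'a \<Rightarrow> 'a \<Rightarrow> real" where
  "bregman R y w x = R x - R y - w \<bullet> (x - y)"

text \<open>The hypothesis \<open>\<forall>x. 0 \<le> bregman R y w x\<close> says that \<open>w\<close> is a subgradient of \<open>R\<close> at \<open>y\<close>.\<close>

definition polyhedral_gaps :: "('a::euclidean_space \<Rightarrow> real) \<Rightarrow> bool" where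
  "polyhedral_gaps R \<longleftrightarrow>
     (\<forall>y w. (\<forall>x. 0 \<le> bregman R y w x) \<longrightarrow> polyhedral_error_bound (bregman R y w))"

lemma bregman_self [simp]: "bregman R y w y = 0"
  by (simp add: bregman_def)

lemma deriv_nonneg_of_right_min:
  fixes h :: "real \<Rightarrow> real"
  assumes "(h has_real_derivative D) (at 0)" "\<And>t. 0 < t \<Longrightarrow> t \<le> 1 \<Longrightarrow> h 0 \<le> h t"
  shows "0 \<le> D"
proof (rule ccontr)
  assume "\<not> 0 \<le> D"
  then obtain d where d: "d > 0" "\<And>t. t > 0 \<Longrightarrow> t < d \<Longrightarrow> h t < h 0"
    using has_real_derivative_neg_dec_right[OF assms(1)] by auto
  have "h (min 1 (d / 2)) < h 0" using d by auto
  moreover have "h 0 \<le> h (min 1 (d / 2))" using d(1) by (intro assms(2)) auto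
  ultimately show False by simp
qed

text \<open>Just to the right of the last zero \<open>\<beta>\<close> of \<open>\<psi>\<close>, the polynomial \<open>q\<close> is comparable to
\<open>(z - \<beta>) ^ m\<close> with \<open>m\<close> the multiplicity of \<open>\<beta>\<close> as a root of \<open>q\<close>; farther right, convexity
keeps \<open>\<psi>\<close> above a positive constant. Using \<open>Suc m\<close> makes the exponent positive also when
\<open>\<beta>\<close> is not a root.\<close>

lemma one_sided_power_bound:
  fixes \<psi> :: "real \<Rightarrow> real"
  assumes conv: "convex_on UNIV \<psi>" and nonneg: "\<And>z. 0 \<le> \<psi> z"
    and zero: "\<psi> \<beta> = 0" and pos: "\<And>z. z > \<beta> \<Longrightarrow> \<psi> z > 0"
    and q: "q \<noteq> 0" "C > 0" "\<And>z. \<bar>z\<bar> \<le> B \<Longrightarrow> \<psi> z \<noteq> 0 \<Longrightarrow> \<bar>poly q z\<bar> \<le> C * \<psi> z"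
    and B: "\<bar>\<beta>\<bar> < B"
  shows "\<exists>k\<ge>1. \<exists>c>0. \<forall>z. \<bar>z\<bar> \<le> B \<longrightarrow> max 0 (z - \<beta>) ^ k \<le> c * \<psi> z"
proof -
  define m where "m = order \<beta> q"
  obtain r where r: "q = [:- \<beta>, 1:] ^ m * r" "\<not> [:- \<beta>, 1:] dvd r"
    using order_decomp[OF q(1), of \<beta>] unfolding m_def by blast
  have r0: "poly r \<beta> \<noteq> 0" using r(2) by (simp add: poly_eq_0_iff_dvd)
  have "((\<lambda>z. \<bar>poly r z\<bar>) \<longlongrightarrow> \<bar>poly r \<beta>\<bar>) (at \<beta>)"
    by (intro tendsto_rabs isContD poly_isCont)
  then have "eventually (\<lambda>z. \<bar>poly r z\<bar> > \<bar>poly r \<beta>\<bar> / 2) (at \<beta>)"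
    using r0 by (intro order_tendstoD(1)) auto
  then obtain d where d: "d > 0" "\<And>z. z \<noteq> \<beta> \<Longrightarrow> dist z \<beta> < d \<Longrightarrow> \<bar>poly r z\<bar> > \<bar>poly r \<beta>\<bar> / 2"
    unfolding eventually_at by blast
  define e where "e = Min {1, d / 2, B - \<beta>}"
  have e: "0 < e" "e \<le> 1" "e < d" "\<beta> + e \<le> B"
    using d(1) B by (auto simp: e_def min_def)
  define \<eta> where "\<eta> = \<psi> (\<beta> + e)"
  have \<eta>: "\<eta> > 0" using pos e by (simp add: \<eta>_def)
  define c1 where "c1 = 2 * C / \<bar>poly r \<beta>\<bar>"
  define c2 where "c2 = (2 * B) ^ Suc m / \<eta>"
  have c: "c1 > 0" "c2 > 0" using q(2) r0 \<eta> B by (auto simp: c1_def c2_def)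
  have "max 0 (z - \<beta>) ^ Suc m \<le> (c1 + c2) * \<psi> z" if z: "\<bar>z\<bar> \<le> B" for z
  proof -
    consider "z \<le> \<beta>" | "\<beta> < z" "z \<le> \<beta> + e" | "\<beta> + e < z" by linarith
    then show ?thesis
    proof cases
      case 1
      then show ?thesis using c nonneg[of z] by simp
    next
      case 2
      have "(z - \<beta>) ^ m * (\<bar>poly r \<beta>\<bar> / 2) \<le> (z - \<beta>) ^ m * \<bar>poly r z\<bar>"
        using 2 d(2)[of z] e(3) by (intro mult_left_mono) (auto simp: dist_real_def less_imp_le)
      also have "\<dots> = \<bar>poly q z\<bar>"
        using 2 by (simp add: r(1) abs_mult power_abs)
      also have "\<dots> \<le> C * \<psi> z"
        using q(3)[OF z] pos[OF 2(1)] by simp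
      finally have "(z - \<beta>) ^ m \<le> c1 * \<psi> z"
        using r0 by (simp add: c1_def field_simps)
      moreover have "(z - \<beta>) ^ Suc m \<le> (z - \<beta>) ^ m"
        using 2 e(2) by (intro power_decreasing) auto
      moreover have "c1 * \<psi> z \<le> (c1 + c2) * \<psi> z"
        using c nonneg[of z] by (intro mult_right_mono) auto
      ultimately have "(z - \<beta>) ^ Suc m \<le> (c1 + c2) * \<psi> z" by linarith
      then show ?thesis using 2(1) by simp
    next
      case 3
      define t where "t = e / (z - \<beta>)"
      have t: "0 \<le> t" "t \<le> 1" using 3 e(1) by (auto simp: t_def field_simps)
      have "t * (z - \<beta>) = e" using 3 e(1) by (simp add: t_def)
      then have eq: "\<beta> + e = (1 - t) *\<^sub>R \<beta> + t *\<^sub>R z" by (simp add: algebra_simps)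
      have "\<eta> \<le> (1 - t) * \<psi> \<beta> + t * \<psi> z"
        unfolding \<eta>_def eq using convex_onD[OF conv t, of \<beta> z] by simp
      also have "\<dots> \<le> \<psi> z"
        using t nonneg[of z] zero by (simp add: mult_left_le_one_le)
      finally have "1 \<le> \<psi> z / \<eta>" using \<eta> by simp
      moreover have "(z - \<beta>) ^ Suc m \<le> (2 * B) ^ Suc m"
        using 3 z B e(1) by (intro power_mono) auto
      ultimately have "(z - \<beta>) ^ Suc m \<le> (2 * B) ^ Suc m * (\<psi> z / \<eta>)"
        using mult_mono[of "(z - \<beta>) ^ Suc m" "(2 * B) ^ Suc m" 1 "\<psi> z / \<eta>"] 3 e(1) B by fastforce
      also have "\<dots> = c2 * \<psi> z" by (simp add: c2_def)
      also have "\<dots> \<le> (c1 + c2) * \<psi> z"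
        using c nonneg[of z] by (intro mult_right_mono) auto
      finally show ?thesis using 3 e(1) by simp
    qed
  qed
  then show ?thesis using c by (intro exI[of _ "Suc m"] conjI exI[of _ "c1 + c2"]) auto
qed

text \<open>The zero set of \<open>\<psi>\<close> is an interval that contains \<open>y\<close>. To the right it is either unbounded, and no
halfspace is needed, or it has a last point \<open>\<beta>\<close>. The left half follows by reflection.\<close>

lemma right_half_error_bound:
  fixes \<psi> :: "real \<Rightarrow> real"
  assumes conv: "convex_on UNIV \<psi>" and nonneg: "\<And>z. 0 \<le> \<psi> z" and zero: "\<psi> y = 0"
    and poly_bound: "\<And>B. \<exists>q C. q \<noteq> 0 \<and> C > 0 \<and> (\<forall>z. \<bar>z\<bar> \<le> B \<longrightarrow> \<psi> z \<noteq> 0 \<longrightarrow> \<bar>poly q z\<bar> \<le> C * \<psi> z)"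
  shows "\<exists>A. finite A \<and> (\<forall>x\<in>halfspaces_inter A. y \<le> x \<longrightarrow> \<psi> x \<le> 0) \<and> (\<forall>p\<in>A. violation_bounded \<psi> p)"
proof (cases "\<exists>z>y. \<psi> z > 0")
  case False
  then show ?thesis
    using zero by (intro exI[of _ "{}"]) (metis empty_iff finite.emptyI le_less not_less)
next
  case True
  then obtain z where z: "y < z" "\<psi> z > 0" by blast
  have cont: "continuous_on UNIV \<psi>"
    using conv by (intro convex_on_continuous) auto
  define Z where "Z = {y..z} \<inter> \<psi> -` {0}"
  have "closed (\<psi> -` {0})"
    using cont by (simp add: continuous_closed_vimage continuous_on_eq_continuous_at)
  then have "compact Z" unfolding Z_def by (intro compact_Int_closed) auto
  moreover have "y \<in> Z" using z zero by (simp add: Z_def)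
  ultimately obtain \<beta> where \<beta>: "\<beta> \<in> Z" "\<And>t. t \<in> Z \<Longrightarrow> t \<le> \<beta>"
    using compact_attains_sup[of Z] by blast
  have pos: "\<psi> t > 0" if "t > \<beta>" for t
  proof (rule ccontr)
    assume "\<not> \<psi> t > 0"
    then have t0: "\<psi> t = 0" using nonneg[of t] by simp
    have "t > z"
    proof (rule ccontr)
      assume "\<not> t > z"
      then have "t \<in> Z" using t0 \<beta>(1) that by (auto simp: Z_def)
      then show False using \<beta>(2) that by fastforce
    qed
    define u where "u = (z - y) / (t - y)"
    have u: "0 \<le> u" "u \<le> 1" using z \<open>t > z\<close> by (auto simp: u_def field_simps)
    have "u * (t - y) = z - y" using z \<open>t > z\<close> by (simp add: u_def)
    then have "z = (1 - u) *\<^sub>R y + u *\<^sub>R t" by (simp add: algebra_simps)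
    then have "\<psi> z \<le> (1 - u) * \<psi> y + u * \<psi> t"
      using convex_onD[OF conv u, of y t] by simp
    then show False using zero t0 z by simp
  qed
  have "violation_bounded \<psi> (1, \<beta>)"
    unfolding violation_bounded_def
  proof
    fix B
    define B' where "B' = max B (\<bar>\<beta>\<bar> + 1)"
    obtain q C where q: "q \<noteq> 0" "C > 0" "\<And>z. \<bar>z\<bar> \<le> B' \<Longrightarrow> \<psi> z \<noteq> 0 \<Longrightarrow> \<bar>poly q z\<bar> \<le> C * \<psi> z"
      using poly_bound[of B'] by blast
    have "\<psi> \<beta> = 0" "\<bar>\<beta>\<bar> < B'" using \<beta> by (auto simp: Z_def B'_def)
    from one_sided_power_bound[OF conv nonneg this(1) pos q this(2)]
    obtain k c where "k \<ge> 1" "c > 0" "\<And>z. \<bar>z\<bar> \<le> B' \<Longrightarrow> max 0 (z - \<beta>) ^ k \<le> c * \<psi> z"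
      by blast
    then show "\<exists>k\<ge>1. \<exists>c>0. \<forall>x. norm x \<le> B \<longrightarrow>
        max 0 (fst (1::real, \<beta>) \<bullet> x - snd (1::real, \<beta>)) ^ k \<le> c * \<psi> x"
      by (intro exI[of _ k] conjI exI[of _ c]) (auto simp: B'_def)
  qed
  moreover have "\<psi> x \<le> 0" if "x \<in> halfspaces_inter {(1, \<beta>)}" "y \<le> x" for x
  proof -
    have "x \<le> \<beta>" using that by (simp add: halfspaces_inter_def)
    show ?thesis
    proof (cases "x = \<beta>")
      case True
      then show ?thesis using \<beta>(1) by (simp add: Z_def)
    next
      case False
      define u where "u = (x - y) / (\<beta> - y)"
      have u: "0 \<le> u" "u \<le> 1" using that \<open>x \<le> \<beta>\<close> False by (auto simp: u_def field_simps)
      have "u * (\<beta> - y) = x - y" using that \<open>x \<le> \<beta>\<close> False by (simp add: u_def)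
      then have "x = (1 - u) *\<^sub>R y + u *\<^sub>R \<beta>" by (simp add: algebra_simps)
      then have "\<psi> x \<le> (1 - u) * \<psi> y + u * \<psi> \<beta>"
        using convex_onD[OF conv u, of y \<beta>] by simp
      then show ?thesis using zero \<beta>(1) by (simp add: Z_def)
    qed
  qed
  ultimately show ?thesis by (intro exI[of _ "{(1, \<beta>)}"]) auto
qed

lemma convex_on_reflect:
  assumes "convex_on UNIV (\<psi> :: 'a::real_vector \<Rightarrow> real)"
  shows "convex_on UNIV (\<lambda>z. \<psi> (- z))"
proof (rule convex_onI)
  fix t :: real and x y :: 'a
  assume t: "0 < t" "t < 1"
  have "- ((1 - t) *\<^sub>R x + t *\<^sub>R y) = (1 - t) *\<^sub>R (- x) + t *\<^sub>R (- y)" by simp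
  then show "\<psi> (- ((1 - t) *\<^sub>R x + t *\<^sub>R y)) \<le> (1 - t) * \<psi> (- x) + t * \<psi> (- y)"
    using convex_onD[OF assms, of t "- x" "- y"] t by simp
qed simp

lemma convex_algebraic_error_bound:
  fixes \<psi> :: "real \<Rightarrow> real"
  assumes conv: "convex_on UNIV \<psi>" and alg: "algebraic_fun \<psi>"
    and nonneg: "\<And>z. 0 \<le> \<psi> z" and zero: "\<psi> y = 0"
  shows "polyhedral_error_bound \<psi>"
proof -
  have cont: "continuous_on S \<psi>" for S
    using convex_on_continuous[OF open_UNIV conv] continuous_on_subset by blast
  have poly_bound: "\<exists>q C. q \<noteq> 0 \<and> C > 0 \<and> (\<forall>z. \<bar>z\<bar> \<le> B \<longrightarrow> \<psi> z \<noteq> 0 \<longrightarrow> \<bar>poly q z\<bar> \<le> C * \<psi> z)" for B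
  proof -
    have "compact (\<psi> ` {-B..B})" by (intro compact_continuous_image cont) auto
    then obtain M where "\<forall>x\<in>\<psi> ` {-B..B}. norm x \<le> M"
      using compact_imp_bounded bounded_iff by blast
    then have "0 \<le> \<psi> z \<and> \<psi> z \<le> M" if "\<bar>z\<bar> \<le> B" for z
      using that nonneg[of z] by (auto simp: abs_le_iff)
    then show ?thesis using algebraic_fun_lower_bound[OF alg, of B M] by metis
  qed
  have poly_bound': "\<exists>q C. q \<noteq> 0 \<and> C > 0 \<and> (\<forall>z. \<bar>z\<bar> \<le> B \<longrightarrow> \<psi> (- z) \<noteq> 0 \<longrightarrow> \<bar>poly q z\<bar> \<le> C * \<psi> (- z))" for B
  proof -
    obtain q C where q: "q \<noteq> 0" "C > 0" "\<And>z. \<bar>z\<bar> \<le> B \<Longrightarrow> \<psi> z \<noteq> 0 \<Longrightarrow> \<bar>poly q z\<bar> \<le> C * \<psi> z"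
      using poly_bound by blast
    have "pcompose q [:0, -1:] \<noteq> 0" using q(1) by (subst pcompose_eq_0_iff) auto
    moreover have "\<bar>poly (pcompose q [:0, -1:]) z\<bar> \<le> C * \<psi> (- z)" if "\<bar>z\<bar> \<le> B" "\<psi> (- z) \<noteq> 0" for z
      using q(3)[of "- z"] that by (simp add: poly_pcompose)
    ultimately show ?thesis using q(2) by blast
  qed
  obtain A1 where A1: "finite A1" "\<And>x. x \<in> halfspaces_inter A1 \<Longrightarrow> y \<le> x \<Longrightarrow> \<psi> x \<le> 0"
    "\<And>p. p \<in> A1 \<Longrightarrow> violation_bounded \<psi> p"
    using right_half_error_bound[OF conv nonneg zero poly_bound] by blast
  have "\<psi> (- (- y)) = 0" using zero by simp
  from right_half_error_bound[OF convex_on_reflect[OF conv] nonneg this poly_bound']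
  obtain A2 where A2: "finite A2" "\<And>x. x \<in> halfspaces_inter A2 \<Longrightarrow> - y \<le> x \<Longrightarrow> \<psi> (- x) \<le> 0"
    "\<And>p. p \<in> A2 \<Longrightarrow> violation_bounded (\<lambda>z. \<psi> (- z)) p"
    by blast
  define A where "A = A1 \<union> (\<lambda>(a, b). (- a, b)) ` A2"
  have "violation_bounded \<psi> (- a, b)" if ab: "(a, b) \<in> A2" for a b
    unfolding violation_bounded_def
  proof
    fix B
    obtain k c where kc: "k \<ge> 1" "c > 0" "\<And>x. norm x \<le> B \<Longrightarrow> max 0 (a \<bullet> x - b) ^ k \<le> c * \<psi> (- x)"
      using A2(3)[OF ab] unfolding violation_bounded_def fst_conv snd_conv by blast
    have "max 0 (fst (- a, b) \<bullet> x - snd (- a, b)) ^ k \<le> c * \<psi> x" if "norm x \<le> B" for x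
      using kc(3)[of "- x"] that by simp
    then show "\<exists>k\<ge>1. \<exists>c>0. \<forall>x. norm x \<le> B \<longrightarrow> max 0 (fst (- a, b) \<bullet> x - snd (- a, b)) ^ k \<le> c * \<psi> x"
      using kc by blast
  qed
  then have "\<forall>p\<in>A. violation_bounded \<psi> p" using A1(3) by (auto simp: A_def)
  moreover have "\<psi> x \<le> 0" if "x \<in> halfspaces_inter A" for x
  proof (cases "y \<le> x")
    case True
    then show ?thesis using that A1(2) by (auto simp: A_def halfspaces_inter_def)
  next
    case False
    have "a \<bullet> (- x) \<le> b" if "(a, b) \<in> A2" for a b
    proof -
      have "(- a, b) \<in> A" using that by (force simp: A_def)
      then show ?thesis using \<open>x \<in> halfspaces_inter A\<close> by (force simp: halfspaces_inter_def)
    qed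
    then have "- x \<in> halfspaces_inter A2" by (auto simp: halfspaces_inter_def)
    then show ?thesis using A2(2)[of "- x"] False by simp
  qed
  moreover have "finite A" using A1(1) A2(1) by (simp add: A_def)
  ultimately show ?thesis unfolding polyhedral_error_bound_def using nonneg by blast
qed

text \<open>Subtracting an affine function preserves convexity and algebraicity, so each gap is again covered
by the error bound for nonnegative functions.\<close>

theorem convex_algebraic_polyhedral_gaps:
  fixes r :: "real \<Rightarrow> real"
  assumes conv: "convex_on UNIV r" and alg: "algebraic_fun r"
  shows "polyhedral_gaps r"
  unfolding polyhedral_gaps_def
proof (intro allI impI)
  fix y w :: real
  assume nonneg: "\<forall>x. 0 \<le> bregman r y w x"
  have eq: "bregman r y w = (\<lambda>x. r x + (- w * x + (w * y - r y)))"
    by (auto simp: bregman_def algebra_simps)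
  have "convex_on UNIV (bregman r y w)"
  proof (rule convex_onI)
    fix t x z :: real assume t: "0 < t" "t < 1"
    have "r ((1 - t) *\<^sub>R x + t *\<^sub>R z) \<le> (1 - t) * r x + t * r z"
      using convex_onD[OF conv, of t x z] t by simp
    then show "bregman r y w ((1 - t) *\<^sub>R x + t *\<^sub>R z) \<le> (1 - t) * bregman r y w x + t * bregman r y w z"
      by (simp add: bregman_def algebra_simps)
  qed simp
  moreover have "algebraic_fun (bregman r y w)"
    unfolding eq using alg by (rule algebraic_fun_add_affine)
  ultimately show "polyhedral_error_bound (bregman r y w)"
    using nonneg by (intro convex_algebraic_error_bound[where y = y]) auto
qed

text \<open>Moving only the block \<open>i\<close> of \<open>y\<close> shows that \<open>w $ i\<close> is a subgradient of \<open>r i\<close>; hence the gap of the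
sum is the sum of the gaps.\<close>

theorem separable_polyhedral_gaps:
  fixes r :: "'n::finite \<Rightarrow> 'a::euclidean_space \<Rightarrow> real"
  assumes gaps: "\<And>i. polyhedral_gaps (r i)"
  shows "polyhedral_gaps (\<lambda>x::'a^'n. \<Sum>i\<in>UNIV. r i (x $ i))"
  unfolding polyhedral_gaps_def
proof (intro allI impI)
  fix y w :: "'a^'n"
  let ?R = "\<lambda>x::'a^'n. \<Sum>i\<in>UNIV. r i (x $ i)"
  assume nonneg: "\<forall>x. 0 \<le> bregman ?R y w x"
  have eq: "bregman ?R y w = (\<lambda>x. \<Sum>i\<in>UNIV. bregman (r i) (y $ i) (w $ i) (x $ i))"
    by (auto simp: bregman_def inner_vec_def sum_subtractf)
  have "0 \<le> bregman (r i) (y $ i) (w $ i) t" for i t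
  proof -
    have "0 \<le> bregman ?R y w (\<chi> j. if j = i then t else y $ j)" using nonneg by blast
    also have "\<dots> = (\<Sum>j\<in>UNIV. if j = i then bregman (r i) (y $ i) (w $ i) t else 0)"
      unfolding eq by (intro sum.cong) auto
    finally show ?thesis by simp
  qed
  then have "polyhedral_error_bound (bregman (r i) (y $ i) (w $ i))" for i
    using gaps[of i] unfolding polyhedral_gaps_def by blast
  then have "polyhedral_error_bound (\<lambda>x. bregman (r i) (y $ i) (w $ i) (x $ i))" for i
    by (rule polyhedral_error_bound_linear) (simp add: bounded_linear.linear bounded_linear_vec_nth)
  then show "polyhedral_error_bound (bregman ?R y w)"
    unfolding eq by (intro polyhedral_error_bound_sum) auto
qed

section \<open>Gaps of norms and of their powers\<close>

lemma pos_homogeneous_lower_bound: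
  fixes \<Phi> :: "'a::euclidean_space \<Rightarrow> real"
  assumes cont: "continuous_on UNIV \<Phi>" and hom: "\<And>t x. t \<ge> 0 \<Longrightarrow> \<Phi> (t *\<^sub>R x) = t * \<Phi> x"
    and pos: "\<And>x. x \<noteq> 0 \<Longrightarrow> \<Phi> x > 0"
  shows "\<exists>m>0. \<forall>x. m * norm x \<le> \<Phi> x"
proof -
  have "sphere (0::'a) 1 \<noteq> {}" by (simp add: sphere_eq_empty)
  moreover have "continuous_on (sphere 0 1) \<Phi>" using cont continuous_on_subset by blast
  ultimately obtain u where u: "u \<in> sphere 0 1" "\<And>v. v \<in> sphere 0 1 \<Longrightarrow> \<Phi> u \<le> \<Phi> v"
    using continuous_attains_inf[OF compact_sphere] by metis
  have "\<Phi> u * norm x \<le> \<Phi> x" for x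
  proof (cases "x = 0")
    case True
    then show ?thesis using hom[of 0 0] by simp
  next
    case False
    have "\<Phi> x = norm x * \<Phi> ((1 / norm x) *\<^sub>R x)"
      using hom[of "norm x" "(1 / norm x) *\<^sub>R x"] False by simp
    moreover have "\<Phi> u \<le> \<Phi> ((1 / norm x) *\<^sub>R x)"
      using False by (intro u(2)) simp
    ultimately show ?thesis
      using mult_right_mono[of "\<Phi> u" "\<Phi> ((1 / norm x) *\<^sub>R x)" "norm x"] by (simp add: mult.commute)
  qed
  moreover have "\<Phi> u > 0" using u(1) by (intro pos) auto
  ultimately show ?thesis by blast
qed

lemma powr_tangent_at_1:
  fixes r p :: real
  assumes "r \<ge> 0" "p \<ge> 1"
  shows "1 + p * (r - 1) \<le> r powr p"
proof (cases "r = 0")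
  case True
  then show ?thesis using assms by simp
next
  case False
  then have r: "r > 0" using assms by simp
  have "((\<lambda>x. x powr p) has_real_derivative p * 1 powr (p - 1)) (at 1 within {0<..})"
    by (rule has_field_derivative_at_within, rule has_real_derivative_powr) simp
  then have "p * 1 powr (p - 1) * (r - 1) \<le> r powr p - 1 powr p"
    using r by (intro convex_on_imp_above_tangent[OF powr_convex[OF assms(2)]]) (auto simp: interior_open)
  then show ?thesis by simp
qed

lemma power_add_le:
  fixes s t :: real
  assumes "s \<ge> 0" "t \<ge> 0"
  shows "(s + t) ^ k \<le> 2 ^ k * (s ^ k + t ^ k)"
proof -
  have "(s + t) ^ k \<le> (2 * max s t) ^ k" using assms by (intro power_mono) auto
  also have "\<dots> = 2 ^ k * max s t ^ k" by (simp add: power_mult_distrib)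
  also have "\<dots> \<le> 2 ^ k * (s ^ k + t ^ k)" using assms by (intro mult_left_mono) (auto simp: max_def)
  finally show ?thesis .
qed

lemma power_bregman_lower:
  fixes a b :: real
  assumes "a \<ge> 0" "b \<ge> 0"
  shows "b ^ j * (a - b)\<^sup>2 \<le> a ^ Suc (Suc j) - b ^ Suc (Suc j) - real (Suc (Suc j)) * b ^ Suc j * (a - b)"
proof (induction j)
  case 0
  then show ?case by (simp add: power2_eq_square algebra_simps)
next
  case (Suc j)
  have "0 \<le> b ^ j * (a - b)\<^sup>2" using assms by simp
  then have "0 \<le> a ^ Suc (Suc j) - b ^ Suc (Suc j) - real (Suc (Suc j)) * b ^ Suc j * (a - b)"
    using Suc by (rule order_trans)
  then have "0 \<le> a * (a ^ Suc (Suc j) - b ^ Suc (Suc j) - real (Suc (Suc j)) * b ^ Suc j * (a - b))"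
    using assms(1) by (rule mult_nonneg_nonneg[rotated])
  moreover have "b ^ Suc j * (a - b)\<^sup>2 \<le> real (Suc (Suc j)) * (b ^ Suc j * (a - b)\<^sup>2)"
    using assms mult_right_mono[of 1 "real (Suc (Suc j))" "b ^ Suc j * (a - b)\<^sup>2"] by simp
  moreover have "a ^ Suc (Suc (Suc j)) - b ^ Suc (Suc (Suc j)) - real (Suc (Suc (Suc j))) * b ^ Suc (Suc j) * (a - b)
      = a * (a ^ Suc (Suc j) - b ^ Suc (Suc j) - real (Suc (Suc j)) * b ^ Suc j * (a - b))
        + real (Suc (Suc j)) * (b ^ Suc j * (a - b)\<^sup>2)"
    by (simp add: power2_eq_square algebra_simps)
  ultimately show ?case by linarith
qed

locale norm_function =
  fixes N :: "'a::euclidean_space \<Rightarrow> real"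
  assumes scale: "N (c *\<^sub>R x) = \<bar>c\<bar> * N x"
    and triangle: "N (x + y) \<le> N x + N y"
    and definite: "N x = 0 \<Longrightarrow> x = 0"
begin

lemma zero [simp]: "N 0 = 0"
  using scale[of 0 0] by simp

lemma minus [simp]: "N (- x) = N x"
  using scale[of "-1" x] by simp

lemma nonneg [simp]: "0 \<le> N x"
  using triangle[of x "- x"] by simp

lemma pos: "x \<noteq> 0 \<Longrightarrow> N x > 0"
  using definite nonneg by (metis less_eq_real_def)

lemma convex: "convex_on UNIV N"
proof (rule convex_onI)
  fix t :: real and x y assume "0 < t" "t < 1"
  then show "N ((1 - t) *\<^sub>R x + t *\<^sub>R y) \<le> (1 - t) * N x + t * N y"
    using triangle[of "(1 - t) *\<^sub>R x" "t *\<^sub>R y"] by (simp add: scale)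
qed simp

lemma convex_power: "convex_on UNIV (\<lambda>x. N x ^ s)"
proof (rule convex_onI)
  fix t :: real and x y assume t: "0 < t" "t < 1"
  have "N ((1 - t) *\<^sub>R x + t *\<^sub>R y) ^ s \<le> ((1 - t) *\<^sub>R N x + t *\<^sub>R N y) ^ s"
    using convex_onD[OF convex, of t x y] t by (intro power_mono) auto
  also have "\<dots> \<le> (1 - t) * N x ^ s + t * N y ^ s"
  proof -
    have "convex_on {0..} (\<lambda>x::real. x ^ s)"
    proof (cases "odd s")
      case True
      then show ?thesis by (rule convex_power_odd)
    next
      case False
      then have "convex_on UNIV (\<lambda>x::real. x ^ s)" by (intro convex_power_even) simp
      then show ?thesis by (rule convex_on_subset) (auto simp: convex_real_interval)
    qed
    from convex_onD[OF this, of t "N x" "N y"] show ?thesis using t by simp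
  qed
  finally show "N ((1 - t) *\<^sub>R x + t *\<^sub>R y) ^ s \<le> (1 - t) * N x ^ s + t * N y ^ s" .
qed simp

lemma continuous: "continuous_on UNIV N"
  using convex by (intro convex_on_continuous) auto

lemma lower_bound: "\<exists>m>0. \<forall>x. m * norm x \<le> N x"
  using continuous by (rule pos_homogeneous_lower_bound) (auto simp: scale pos)

lemma upper_bound: "\<exists>M>0. \<forall>x. norm x \<le> B \<longrightarrow> N x \<le> M"
proof -
  have "compact (N ` cball 0 B)"
    by (intro compact_continuous_image) (auto intro: continuous_on_subset[OF continuous])
  then obtain M where "M > 0" "\<forall>y\<in>N ` cball 0 B. norm y \<le> M"
    using compact_imp_bounded bounded_pos by blast
  then show ?thesis by (intro exI[of _ M]) auto
qed

lemma bounded_power_sublevel: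
  assumes "s \<ge> 1"
  shows "bounded {x. N x ^ s \<le> B}"
proof -
  obtain m where m: "m > 0" "\<And>x. m * norm x \<le> N x" using lower_bound by blast
  have "norm x \<le> (1 + \<bar>B\<bar>) / m" if "N x ^ s \<le> B" for x
  proof -
    have "N x \<le> 1 + \<bar>B\<bar>"
    proof (rule ccontr)
      assume *: "\<not> N x \<le> 1 + \<bar>B\<bar>"
      then have "N x ^ 1 \<le> N x ^ s" using assms by (intro power_increasing) auto
      then show False using * that by simp
    qed
    then have "m * norm x \<le> 1 + \<bar>B\<bar>" using m(2)[of x] by linarith
    then show ?thesis using m(1) by (simp add: field_simps)
  qed
  then show ?thesis by (auto simp: bounded_iff)
qed

text \<open>Testing a subgradient at \<open>0\<close> and at \<open>2 y\<close> gives \<open>w \<bullet> y = N y\<close>, so the gap of a norm does not depend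
on \<open>y\<close>.\<close>

lemma bregman_eq:
  assumes "\<And>x. 0 \<le> bregman N y w x"
  shows "w \<bullet> x \<le> N x" "bregman N y w = (\<lambda>x. N x - w \<bullet> x)"
proof -
  have "w \<bullet> y = N y"
    using assms[of 0] assms[of "2 *\<^sub>R y"] by (simp add: bregman_def scale inner_diff_right)
  then show eq: "bregman N y w = (\<lambda>x. N x - w \<bullet> x)"
    by (auto simp: bregman_def inner_diff_right)
  show "w \<bullet> x \<le> N x"
    using assms[of x] unfolding eq by simp
qed

text \<open>For the \<open>\<ell>\<^sub>p\<close>-norm the power \<open>N\<^sup>p\<close> is separable while \<open>N\<close> itself is not, and this lemma transfers the
bound. Let \<open>w\<close> be a subgradient of \<open>N\<close>. If \<open>w \<bullet> v < 1\<close> for all \<open>v\<close> with \<open>N v = 1\<close>, then \<open>N x - w \<bullet> x\<close> grows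
linearly and \<open>0\<close> is its only zero. If \<open>w \<bullet> v = 1\<close> for some such \<open>v\<close>, then \<open>p w\<close> is a subgradient of \<open>N\<^sup>p\<close> at \<open>v\<close>,
and on the unit sphere \<open>N x = 1\<close> the gap \<open>D\<close> of \<open>N\<^sup>p\<close> is \<open>p\<close> times the gap \<open>\<Gamma>\<close> of \<open>N\<close>. A constraint
\<open>a \<bullet> x \<le> b\<close> for \<open>D\<close> becomes \<open>a \<bullet> x \<le> b * N x\<close> after scaling; replacing \<open>N x\<close> by \<open>w \<bullet> x\<close> makes
it linear, at the price of the error \<open>\<bar>b\<bar> * \<Gamma> x\<close>.\<close>

lemma polyhedral_gaps_of_powr:
  assumes gaps: "polyhedral_gaps (\<lambda>x. N x powr p)" and p: "p > 1"
  shows "polyhedral_gaps N"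
  unfolding polyhedral_gaps_def
proof (intro allI impI)
  fix y w assume sub: "\<forall>x. 0 \<le> bregman N y w x"
  define \<Gamma> where "\<Gamma> x = N x - w \<bullet> x" for x
  have w: "w \<bullet> x \<le> N x" for x using sub bregman_eq by blast
  have eq: "bregman N y w = \<Gamma>" using sub bregman_eq(2) unfolding \<Gamma>_def by blast
  have \<Gamma>: "0 \<le> \<Gamma> x" "\<Gamma> x \<le> 2 * N x" for x
    using w[of x] w[of "- x"] by (auto simp: \<Gamma>_def)
  show "polyhedral_error_bound (bregman N y w)"
  proof (cases "\<exists>v. N v = 1 \<and> w \<bullet> v = 1")
    case False
    have "\<Gamma> x > 0" if "x \<noteq> 0" for x
    proof (rule ccontr)
      assume "\<not> \<Gamma> x > 0"
      then have "w \<bullet> x = N x" using \<Gamma>(1)[of x] by (auto simp: \<Gamma>_def)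
      then have "N ((1 / N x) *\<^sub>R x) = 1 \<and> w \<bullet> ((1 / N x) *\<^sub>R x) = 1"
        using pos[OF that] by (simp add: scale)
      then show False using False by blast
    qed
    moreover have "continuous_on UNIV \<Gamma>"
      unfolding \<Gamma>_def by (intro continuous_intros continuous)
    ultimately obtain m where "m > 0" "\<And>x. m * norm x \<le> \<Gamma> x"
      using pos_homogeneous_lower_bound[of \<Gamma>] by (auto simp: \<Gamma>_def scale algebra_simps)
    then show ?thesis
      unfolding eq by (intro polyhedral_error_bound_point[of 1 m]) (auto simp: \<Gamma>_def)
  next
    case True
    then obtain v where v: "N v = 1" "w \<bullet> v = 1" by blast
    define D where "D = bregman (\<lambda>x. N x powr p) v (p *\<^sub>R w)"
    have D_eq: "D x = N x powr p - 1 - p * (w \<bullet> x - 1)" for x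
      by (simp add: D_def bregman_def inner_diff_right v right_diff_distrib)
    have D_nonneg: "0 \<le> D x" for x
    proof -
      have "p * (w \<bullet> x - 1) \<le> p * (N x - 1)"
        using w[of x] p by (intro mult_left_mono) auto
      then show ?thesis
        using powr_tangent_at_1[OF nonneg[of x] less_imp_le[OF p]] unfolding D_eq by linarith
    qed
    have "polyhedral_error_bound D"
      using gaps D_nonneg unfolding polyhedral_gaps_def D_def by blast
    then obtain A where A: "finite A" "\<And>x. x \<in> halfspaces_inter A \<Longrightarrow> D x \<le> 0"
      "\<And>q. q \<in> A \<Longrightarrow> violation_bounded D q"
      unfolding polyhedral_error_bound_def by blast
    \<comment> \<open>The homogenized constraints, together with the condition that w is nonnegative along x.\<close>
    define A' where "A' = insert (- w, 0::real) ((\<lambda>q. (fst q - snd q *\<^sub>R w, 0)) ` A)"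
    have "violation_bounded \<Gamma> (- w, 0)"
      unfolding violation_bounded_def
    proof
      fix B
      have "max 0 (fst (- w, 0::real) \<bullet> x - snd (- w, 0::real)) ^ 1 \<le> 1 * \<Gamma> x" for x
        using \<Gamma>(1)[of x] nonneg[of x] by (simp add: \<Gamma>_def)
      then show "\<exists>k\<ge>1. \<exists>c>0. \<forall>x. norm x \<le> B \<longrightarrow>
          max 0 (fst (- w, 0::real) \<bullet> x - snd (- w, 0::real)) ^ k \<le> c * \<Gamma> x"
        by (intro exI[of _ 1] conjI) auto
    qed
    moreover have "violation_bounded \<Gamma> (a - b *\<^sub>R w, 0)" if ab: "(a, b) \<in> A" for a b
      unfolding violation_bounded_def
    proof
      fix B
      obtain m where m: "m > 0" "\<And>x. m * norm x \<le> N x" using lower_bound by blast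
      obtain M where M: "M > 0" "\<And>x. norm x \<le> B \<Longrightarrow> N x \<le> M" using upper_bound by blast
      obtain k c where kc: "k \<ge> 1" "c > 0"
        "\<And>x. norm x \<le> 1 / m \<Longrightarrow> max 0 (a \<bullet> x - b) ^ k \<le> c * D x"
        using A(3)[OF ab] unfolding violation_bounded_def fst_conv snd_conv by blast
      obtain j where k: "k = Suc j" using kc(1) by (cases k) auto
      define K where "K = 2 ^ k * (M ^ j * (c * p) + \<bar>b\<bar> ^ k * (2 * M) ^ j)"
      have "max 0 ((a - b *\<^sub>R w) \<bullet> x) ^ k \<le> K * \<Gamma> x" if x: "norm x \<le> B" for x
      proof (cases "x = 0")
        case True
        then show ?thesis using k by (simp add: \<Gamma>_def)
      next
        case False
        then have Npos: "N x > 0" by (rule pos)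
        define u where "u = (1 / N x) *\<^sub>R x"
        have Nu: "N u = 1" using Npos by (simp add: u_def scale)
        have x_eq: "x = N x *\<^sub>R u" using Npos by (simp add: u_def)
        \<comment> \<open>The violation is at most s + t, with s inherited from D at the normalized point u
          and t the error of replacing N x by the linear form.\<close>
        define s t where "s = max 0 (a \<bullet> x - b * N x)" and "t = \<bar>b\<bar> * \<Gamma> x"
        have "(a - b *\<^sub>R w) \<bullet> x = (a \<bullet> x - b * N x) + b * \<Gamma> x"
          by (simp add: \<Gamma>_def inner_diff_left algebra_simps)
        also have "\<dots> \<le> s + t"
          using \<Gamma>(1)[of x] by (intro add_mono) (auto simp: s_def t_def intro: mult_right_mono)
        finally have "max 0 ((a - b *\<^sub>R w) \<bullet> x) \<le> s + t"
          using \<Gamma>(1)[of x] by (simp add: s_def t_def)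
        then have "max 0 ((a - b *\<^sub>R w) \<bullet> x) ^ k \<le> (s + t) ^ k" by (intro power_mono) auto
        also have "\<dots> \<le> 2 ^ k * (s ^ k + t ^ k)"
          using \<Gamma>(1)[of x] by (intro power_add_le) (auto simp: s_def t_def)
        also have "s ^ k \<le> M ^ j * (c * p) * \<Gamma> x"
        proof -
          have "norm u \<le> 1 / m" using m(2)[of u] m(1) Nu by (simp add: field_simps)
          have "s = N x * max 0 (a \<bullet> u - b)"
          proof -
            have "a \<bullet> x = N x * (a \<bullet> u)" by (subst x_eq) simp
            then have "a \<bullet> x - b * N x = N x * (a \<bullet> u - b)" by (simp add: algebra_simps)
            then show ?thesis using Npos by (simp add: s_def max_mult_distrib_left)
          qed
          then have "s ^ k = N x ^ k * max 0 (a \<bullet> u - b) ^ k" by (simp add: power_mult_distrib)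
          also have "\<dots> \<le> N x ^ k * (c * D u)"
            using kc(3)[OF \<open>norm u \<le> 1 / m\<close>] by (intro mult_left_mono) auto
          also have "\<dots> = N x ^ j * (c * p * \<Gamma> x)"
          proof -
            have "w \<bullet> x = N x * (w \<bullet> u)" by (subst x_eq) simp
            then have "N x * D u = p * \<Gamma> x"
              unfolding D_eq Nu \<Gamma>_def by (simp add: right_diff_distrib)
            then show ?thesis by (simp add: k algebra_simps)
          qed
          also have "\<dots> \<le> M ^ j * (c * p * \<Gamma> x)"
            using M(2)[OF x] kc(2) p \<Gamma>(1)[of x] by (intro mult_right_mono power_mono) auto
          finally show ?thesis by (simp add: mult.assoc)
        qed
        also have "t ^ k \<le> \<bar>b\<bar> ^ k * (2 * M) ^ j * \<Gamma> x"
        proof -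
          have "\<Gamma> x ^ j \<le> (2 * M) ^ j"
            using \<Gamma>[of x] M(2)[OF x] by (intro power_mono) auto
          then have "\<Gamma> x ^ j * \<Gamma> x \<le> (2 * M) ^ j * \<Gamma> x"
            using \<Gamma>(1)[of x] by (intro mult_right_mono) auto
          then have "\<bar>b\<bar> ^ k * (\<Gamma> x ^ j * \<Gamma> x) \<le> \<bar>b\<bar> ^ k * ((2 * M) ^ j * \<Gamma> x)"
            by (intro mult_left_mono) auto
          then show ?thesis by (simp add: t_def k power_mult_distrib algebra_simps)
        qed
        finally show ?thesis by (simp add: K_def algebra_simps)
      qed
      moreover have "K > 0"
        using M(1) kc(2) p unfolding K_def
        by (intro mult_pos_pos add_pos_nonneg mult_nonneg_nonneg) auto
      ultimately show "\<exists>k\<ge>1. \<exists>c>0. \<forall>x. norm x \<le> B \<longrightarrow>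
          max 0 (fst (a - b *\<^sub>R w, 0::real) \<bullet> x - snd (a - b *\<^sub>R w, 0::real)) ^ k \<le> c * \<Gamma> x"
        using kc(1) by (intro exI[of _ k] conjI exI[of _ K]) auto
    qed
    ultimately have "\<forall>q\<in>A'. violation_bounded \<Gamma> q" by (auto simp: A'_def)
    moreover have "\<Gamma> x \<le> 0" if x: "x \<in> halfspaces_inter A'" for x
    proof -
      have wx: "0 \<le> w \<bullet> x" using x by (auto simp: halfspaces_inter_def A'_def)
      have ax: "a \<bullet> x \<le> b * (w \<bullet> x)" if "(a, b) \<in> A" for a b
        using x that by (force simp: halfspaces_inter_def A'_def inner_diff_left)
      show ?thesis
      proof (cases "w \<bullet> x = 0")
        case False
        \<comment> \<open>Dividing by w x brings x into the polyhedron of D, where N is at most 1.\<close>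
        define t where "t = w \<bullet> x"
        have t: "t > 0" using False wx by (simp add: t_def)
        have "(1 / t) *\<^sub>R x \<in> halfspaces_inter A"
          using ax t by (auto simp: halfspaces_inter_def t_def[symmetric] field_simps)
        then have "D ((1 / t) *\<^sub>R x) \<le> 0" by (rule A(2))
        then have "N ((1 / t) *\<^sub>R x) powr p \<le> 1"
          using t by (simp add: D_eq t_def[symmetric])
        then have "N ((1 / t) *\<^sub>R x) \<le> 1"
          using p powr_less_mono2[of p 1 "N ((1 / t) *\<^sub>R x)"] by (force simp: not_le[symmetric])
        then show ?thesis using t by (simp add: scale \<Gamma>_def t_def[symmetric])
      next
        case True
        \<comment> \<open>The constraints then keep the whole ray from v in direction x inside the unit ball,
          which forces x = 0.\<close>
        have le1: "N (v + s *\<^sub>R x) \<le> 1" if "s \<ge> 0" for s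
        proof -
          have "a \<bullet> v \<le> b" if ab: "(a, b) \<in> A" for a b
          proof -
            obtain k c where "k \<ge> 1" "max 0 (a \<bullet> v - b) ^ k \<le> c * D v"
              using A(3)[OF ab] unfolding violation_bounded_def fst_conv snd_conv by blast
            moreover have "D v = 0" by (simp add: D_def)
            ultimately have "max 0 (a \<bullet> v - b) ^ k = 0"
              by (intro antisym) auto
            then show ?thesis by auto
          qed
          moreover have "s * (a \<bullet> x) \<le> 0" if "(a, b) \<in> A" for a b
            using ax[OF that] True \<open>s \<ge> 0\<close> by (simp add: mult_le_0_iff)
          ultimately have "v + s *\<^sub>R x \<in> halfspaces_inter A"
            by (fastforce simp: halfspaces_inter_def inner_add_right)
          then have "D (v + s *\<^sub>R x) \<le> 0" by (rule A(2))
          then have "N (v + s *\<^sub>R x) powr p \<le> 1"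
            using True v by (simp add: D_eq inner_add_right)
          then show ?thesis
            using p powr_less_mono2[of p 1 "N (v + s *\<^sub>R x)"] by (force simp: not_le[symmetric])
        qed
        have "N x = 0"
        proof (rule ccontr)
          assume "N x \<noteq> 0"
          then have Nx: "N x > 0" using nonneg[of x] by linarith
          \<comment> \<open>A step of length 3 leaves the unit ball, as v has norm 1.\<close>
          have "N ((3 / N x) *\<^sub>R x) \<le> N (v + (3 / N x) *\<^sub>R x) + N (- v)"
            using triangle[of "v + (3 / N x) *\<^sub>R x" "- v"] by simp
          also have "\<dots> \<le> 2" using le1[of "3 / N x"] Nx v(1) by simp
          finally show False using Nx by (simp add: scale)
        qed
        then show ?thesis using True by (simp add: \<Gamma>_def)
      qed
    qed
    moreover have "finite A'" using A(1) by (simp add: A'_def)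
    ultimately show ?thesis
      unfolding eq polyhedral_error_bound_def using \<Gamma>(1) by blast
  qed
qed

text \<open>Let \<open>s \<ge> 2\<close>, \<open>\<rho> = N y > 0\<close> and \<open>c = s \<rho>\<^bsup>s-1\<^esup>\<close>. Then \<open>u = w / c\<close> is a subgradient of \<open>N\<close> at \<open>y\<close>, and the gap
of \<open>N\<^sup>s\<close> splits into the gap of \<open>t \<mapsto> t\<^sup>s\<close> between \<open>\<rho>\<close> and \<open>N x\<close>, which is at least
\<open>\<rho>\<^bsup>s-2\<^esup> (N x - \<rho>)\<^sup>2\<close>, and \<open>c\<close> times the gap of \<open>N\<close>. Both vanish exactly where the constraints of
\<open>N x - u \<bullet> x\<close> hold and \<open>u \<bullet> x = \<rho>\<close>. For \<open>\<rho> = 0\<close> the only subgradient is \<open>0\<close>.\<close>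

lemma polyhedral_gaps_power:
  assumes gaps: "polyhedral_gaps N" and s: "s \<ge> 1"
  shows "polyhedral_gaps (\<lambda>x. N x ^ s)"
proof (cases "s = 1")
  case True
  then show ?thesis using gaps by simp
next
  case False
  define j where "j = s - 2"
  have sj: "s = Suc (Suc j)" using s False by (simp add: j_def)
  show ?thesis
    unfolding polyhedral_gaps_def
  proof (intro allI impI)
    fix y w assume sub: "\<forall>x. 0 \<le> bregman (\<lambda>x. N x ^ s) y w x"
    define \<rho> where "\<rho> = N y"
    show "polyhedral_error_bound (bregman (\<lambda>x. N x ^ s) y w)"
    proof (cases "\<rho> = 0")
      case True
      then have y: "y = 0" using definite by (simp add: \<rho>_def)
      have "0 \<le> - (w \<bullet> w)"
      proof (rule deriv_nonneg_of_right_min)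
        show "((\<lambda>t. t ^ s * N w ^ s - t * (w \<bullet> w)) has_real_derivative - (w \<bullet> w)) (at 0)"
          by (auto intro!: derivative_eq_intros simp: sj)
        show "0 ^ s * N w ^ s - 0 * (w \<bullet> w) \<le> t ^ s * N w ^ s - t * (w \<bullet> w)" if "0 < t" "t \<le> 1" for t
          using spec[OF sub, of "t *\<^sub>R w"] that
          by (simp add: bregman_def y scale sj power_mult_distrib mult_ac)
      qed
      then have "w = 0" by (metis inner_ge_zero inner_eq_zero_iff neg_0_le_iff_le order_antisym)
      then have eq: "bregman (\<lambda>x. N x ^ s) y w = (\<lambda>x. N x ^ s)"
        by (auto simp: bregman_def y sj)
      obtain m where m: "m > 0" "\<And>x. m * norm x \<le> N x" using lower_bound by blast
      have "m ^ s * norm x ^ s \<le> N x ^ s" for x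
        using power_mono[OF m(2), of x s] m(1) by (simp add: power_mult_distrib)
      then show ?thesis
        unfolding eq using m(1) s by (intro polyhedral_error_bound_point[of s "m ^ s"]) (auto simp: sj)
    next
      case False
      then have \<rho>: "\<rho> > 0" using nonneg[of y] unfolding \<rho>_def by linarith
      define c where "c = real s * \<rho> ^ Suc j"
      have c: "c > 0" using \<rho> by (simp add: c_def sj)
      \<comment> \<open>Euler's identity, from optimality along the ray through y.\<close>
      have wy: "w \<bullet> y = c * \<rho>"
      proof -
        have "((\<lambda>t. \<rho> ^ s * (1 + t) ^ s - t * (w \<bullet> y)) has_real_derivative c * \<rho> - w \<bullet> y) (at 0)"
          by (auto intro!: derivative_eq_intros simp: sj c_def)
        moreover have "\<rho> ^ s * (1 + 0) ^ s - 0 * (w \<bullet> y) \<le> \<rho> ^ s * (1 + t) ^ s - t * (w \<bullet> y)"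
          if "\<bar>0 - t\<bar> < 1" for t
        proof -
          have "N ((1 + t) *\<^sub>R y) = (1 + t) * \<rho>" using that by (simp add: scale \<rho>_def)
          moreover have "(1 + t) *\<^sub>R y - y = t *\<^sub>R y" by (simp add: algebra_simps)
          ultimately show ?thesis
            using spec[OF sub, of "(1 + t) *\<^sub>R y"]
            by (simp add: bregman_def \<rho>_def[symmetric] power_mult_distrib mult.commute)
        qed
        ultimately have "c * \<rho> - w \<bullet> y = 0"
          by (intro DERIV_local_min[where d = 1]) auto
        then show ?thesis by simp
      qed
      \<comment> \<open>The subgradient inequality at the multiple of x of norm rho.\<close>
      have wx: "w \<bullet> x \<le> c * N x" for x
      proof (cases "x = 0")
        case False
        then have Nx: "N x > 0" by (rule pos)
        have "0 \<le> bregman (\<lambda>x. N x ^ s) y w ((\<rho> / N x) *\<^sub>R x)" using sub by blast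
        also have "\<dots> = w \<bullet> y - (\<rho> / N x) * (w \<bullet> x)"
          using Nx \<rho> by (simp add: bregman_def scale \<rho>_def[symmetric] inner_diff_right)
        finally have "(\<rho> / N x) * (w \<bullet> x) \<le> c * \<rho>" using wy by simp
        then show ?thesis using Nx \<rho> by (simp add: field_simps)
      qed simp
      define u where "u = (1 / c) *\<^sub>R w"
      have cu: "w = c *\<^sub>R u" using c by (simp add: u_def)
      have ux: "u \<bullet> x \<le> N x" for x using wx[of x] c by (simp add: cu)
      have uy: "u \<bullet> y = \<rho>" using wy c by (simp add: cu)
      define \<Gamma> where "\<Gamma> x = N x - u \<bullet> x" for x
      have \<Gamma>_nonneg: "0 \<le> \<Gamma> x" for x using ux[of x] by (simp add: \<Gamma>_def)
      have "bregman N y u = \<Gamma>"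
        by (auto simp: bregman_def \<Gamma>_def inner_diff_right uy \<rho>_def[symmetric])
      then have "polyhedral_error_bound \<Gamma>"
        using gaps \<Gamma>_nonneg unfolding polyhedral_gaps_def by metis
      then obtain A where A: "finite A" "\<And>x. x \<in> halfspaces_inter A \<Longrightarrow> \<Gamma> x \<le> 0"
        "\<And>q. q \<in> A \<Longrightarrow> violation_bounded \<Gamma> q"
        unfolding polyhedral_error_bound_def by blast
      define \<Psi> where "\<Psi> = bregman (\<lambda>x. N x ^ s) y w"
      define E where "E x = N x ^ s - \<rho> ^ s - c * (N x - \<rho>)" for x
      have \<Psi>_eq: "\<Psi> x = E x + c * \<Gamma> x" for x
        using uy by (simp add: \<Psi>_def bregman_def E_def \<Gamma>_def \<rho>_def[symmetric] cu inner_diff_right algebra_simps)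
      have E_lower: "\<rho> ^ j * (N x - \<rho>)\<^sup>2 \<le> E x" for x
        using power_bregman_lower[of "N x" \<rho> j] \<rho> by (simp add: E_def c_def sj)
      have E_nonneg: "0 \<le> E x" for x
        using E_lower[of x] \<rho> by (meson mult_nonneg_nonneg order_trans zero_le_power2 zero_le_power less_imp_le)
      have touching: "\<exists>K>0. \<forall>x. norm x \<le> B \<longrightarrow> \<bar>u \<bullet> x - \<rho>\<bar>\<^sup>2 \<le> K * \<Psi> x" for B
      proof -
        obtain M where M: "M > 0" "\<And>x. norm x \<le> B \<Longrightarrow> N x \<le> M" using upper_bound by blast
        define K where "K = 4 * (1 / \<rho> ^ j + 2 * M / c)"
        have "\<bar>u \<bullet> x - \<rho>\<bar>\<^sup>2 \<le> K * \<Psi> x" if x: "norm x \<le> B" for x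
        proof -
          have "\<bar>u \<bullet> x - \<rho>\<bar> \<le> \<bar>N x - \<rho>\<bar> + \<Gamma> x"
            using \<Gamma>_nonneg[of x] by (simp add: \<Gamma>_def)
          then have "\<bar>u \<bullet> x - \<rho>\<bar>\<^sup>2 \<le> (\<bar>N x - \<rho>\<bar> + \<Gamma> x)\<^sup>2" by (intro power_mono) auto
          also have "\<dots> \<le> 2\<^sup>2 * (\<bar>N x - \<rho>\<bar>\<^sup>2 + (\<Gamma> x)\<^sup>2)"
            using \<Gamma>_nonneg by (intro power_add_le) auto
          also have "\<bar>N x - \<rho>\<bar>\<^sup>2 \<le> 1 / \<rho> ^ j * \<Psi> x"
          proof -
            have "\<rho> ^ j * (N x - \<rho>)\<^sup>2 \<le> \<Psi> x"
              using E_lower[of x] c \<Gamma>_nonneg[of x] by (simp add: \<Psi>_eq add_increasing2)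
            then show ?thesis using \<rho> by (simp add: field_simps)
          qed
          also have "(\<Gamma> x)\<^sup>2 \<le> 2 * M / c * \<Psi> x"
          proof -
            have "\<Gamma> x \<le> 2 * M"
              using ux[of "- x"] M(2)[OF x] by (simp add: \<Gamma>_def)
            then have "\<Gamma> x * \<Gamma> x \<le> 2 * M * \<Gamma> x"
              using \<Gamma>_nonneg[of x] by (intro mult_right_mono) auto
            moreover have "\<Gamma> x \<le> \<Psi> x / c"
              using E_nonneg[of x] c by (simp add: \<Psi>_eq field_simps)
            then have "2 * M * \<Gamma> x \<le> 2 * M * (\<Psi> x / c)"
              using M(1) by (intro mult_left_mono) auto
            ultimately show ?thesis by (simp add: power2_eq_square)
          qed
          finally show ?thesis by (simp add: K_def algebra_simps)
        qed
        moreover have "K > 0"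
          using \<rho> M(1) c by (auto simp: K_def intro!: add_pos_pos)
        ultimately show ?thesis by blast
      qed
      have viol: "violation_bounded \<Psi> (\<sigma> *\<^sub>R u, \<sigma> * \<rho>)" if \<sigma>: "\<bar>\<sigma>\<bar> = 1" for \<sigma>
        unfolding violation_bounded_def
      proof
        fix B
        obtain K where K: "K > 0" "\<And>x. norm x \<le> B \<Longrightarrow> \<bar>u \<bullet> x - \<rho>\<bar>\<^sup>2 \<le> K * \<Psi> x"
          using touching by blast
        have "max 0 (fst (\<sigma> *\<^sub>R u, \<sigma> * \<rho>) \<bullet> x - snd (\<sigma> *\<^sub>R u, \<sigma> * \<rho>)) ^ 2 \<le> K * \<Psi> x"
          if "norm x \<le> B" for x
        proof -
          have "\<bar>\<sigma> * (u \<bullet> x - \<rho>)\<bar> = \<bar>u \<bullet> x - \<rho>\<bar>" using \<sigma> by (simp add: abs_mult)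
          then have "max 0 (\<sigma> * (u \<bullet> x) - \<sigma> * \<rho>) \<le> \<bar>u \<bullet> x - \<rho>\<bar>"
            by (simp add: right_diff_distrib)
          then have "max 0 (\<sigma> * (u \<bullet> x) - \<sigma> * \<rho>) ^ 2 \<le> \<bar>u \<bullet> x - \<rho>\<bar> ^ 2"
            by (intro power_mono) auto
          then show ?thesis using K(2)[OF that] by simp
        qed
        then show "\<exists>k\<ge>1. \<exists>c>0. \<forall>x. norm x \<le> B \<longrightarrow>
            max 0 (fst (\<sigma> *\<^sub>R u, \<sigma> * \<rho>) \<bullet> x - snd (\<sigma> *\<^sub>R u, \<sigma> * \<rho>)) ^ k \<le> c * \<Psi> x"
          using K(1) by (intro exI[of _ "2::nat"] conjI exI[of _ K]) auto
      qed
      define A' where "A' = {(1 *\<^sub>R u, 1 * \<rho>), (- 1 *\<^sub>R u, - 1 * \<rho>)} \<union> A"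
      have "violation_bounded \<Psi> q" if q: "q \<in> A" for q
        using A(3)[OF q]
      proof (rule violation_bounded_mono[of _ _ "1 / c"])
        show "\<Gamma> x \<le> 1 / c * \<Psi> x" for x
          using E_nonneg[of x] c by (simp add: \<Psi>_eq field_simps)
      qed (use c in simp)
      then have "\<forall>q\<in>A'. violation_bounded \<Psi> q"
        using viol[of 1] viol[of "-1"] unfolding A'_def by auto
      moreover have "\<Psi> x \<le> 0" if x: "x \<in> halfspaces_inter A'" for x
      proof -
        have "u \<bullet> x = \<rho>" using x by (auto simp: halfspaces_inter_def A'_def)
        moreover have "\<Gamma> x \<le> 0"
          using x by (intro A(2)) (auto simp: halfspaces_inter_def A'_def)
        then have "\<Gamma> x = 0" using \<Gamma>_nonneg[of x] by simp
        ultimately show ?thesis by (simp add: \<Psi>_eq E_def \<Gamma>_def)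
      qed
      moreover have "finite A'" using A(1) by (simp add: A'_def)
      moreover have "0 \<le> \<Psi> x" for x using sub by (simp add: \<Psi>_def)
      ultimately show ?thesis
        unfolding \<Psi>_def[symmetric] polyhedral_error_bound_def by blast
    qed
  qed
qed

end

section \<open>The regularizers\<close>

lemma abs_powr_convex:
  assumes "p \<ge> 1"
  shows "convex_on UNIV (\<lambda>t::real. \<bar>t\<bar> powr p)"
proof (rule convex_onI)
  fix t x y :: real assume t: "0 < t" "t < 1"
  have scaled: "(s * z) powr p \<le> s * z powr p" if "0 < s" "s < 1" "0 \<le> z" for s z :: real
  proof -
    have "s powr p \<le> s powr 1" using that assms by (intro powr_mono') auto
    then have "s powr p * z powr p \<le> s * z powr p"
      using that by (intro mult_right_mono) auto
    then show ?thesis using that by (simp add: powr_mult)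
  qed
  have conv: "((1 - t) * u + t * v) powr p \<le> (1 - t) * u powr p + t * v powr p"
    if uv: "0 \<le> u" "0 \<le> v" for u v
  proof (cases "u = 0 \<or> v = 0")
    case True
    then show ?thesis using scaled[of t v] scaled[of "1 - t" u] t uv assms by auto
  next
    case False
    then show ?thesis
      using convex_onD[OF powr_convex[OF assms], of t u v] t uv by simp
  qed
  have "\<bar>(1 - t) * x + t * y\<bar> \<le> (1 - t) * \<bar>x\<bar> + t * \<bar>y\<bar>"
    using abs_triangle_ineq[of "(1 - t) * x" "t * y"] t by (simp add: abs_mult)
  then have "\<bar>(1 - t) * x + t * y\<bar> powr p \<le> ((1 - t) * \<bar>x\<bar> + t * \<bar>y\<bar>) powr p"
    using assms by (intro powr_mono2) auto
  also have "\<dots> \<le> (1 - t) * \<bar>x\<bar> powr p + t * \<bar>y\<bar> powr p" by (intro conv) auto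
  finally show "\<bar>(1 - t) *\<^sub>R x + t *\<^sub>R y\<bar> powr p \<le> (1 - t) * \<bar>x\<bar> powr p + t * \<bar>y\<bar> powr p"
    by simp
qed simp

text \<open>For \<open>p = m / n\<close> the graph lies on the curve \<open>y ^ (2 * n) = z ^ (2 * m)\<close>; the even exponents remove the
absolute value. This is where rationality of \<open>p\<close> enters.\<close>

lemma abs_powr_algebraic:
  assumes "p \<in> \<rat>" "p \<ge> 1"
  shows "algebraic_fun (\<lambda>t. \<bar>t\<bar> powr p)"
proof -
  obtain m n :: nat where mn: "n \<noteq> 0" "\<bar>p\<bar> = real m / real n"
    using Rats_abs_nat_div_natE[OF assms(1)] by metis
  have m: "m \<noteq> 0" using mn assms(2) by (cases "m = 0") auto
  define Q :: "real poly poly" where "Q = [:0, 1:] ^ (2 * n) - [:monom 1 (2 * m):]"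
  have "poly2 Q 0 1 = 1" using m by (simp add: Q_def poly_monom)
  then have "Q \<noteq> 0" by force
  moreover have "poly2 Q z (\<bar>z\<bar> powr p) = 0" for z
  proof -
    have "(\<bar>z\<bar> powr p) ^ (2 * n) = z ^ (2 * m)"
    proof (cases "z = 0")
      case False
      have "(\<bar>z\<bar> powr p) ^ (2 * n) = \<bar>z\<bar> powr (p * real (2 * n))"
        using False by (simp add: powr_powr flip: powr_realpow)
      also have "p * real (2 * n) = real (2 * m)" using mn assms(2) by simp
      also have "\<bar>z\<bar> powr real (2 * m) = \<bar>z\<bar> ^ (2 * m)" using False by (intro powr_realpow) simp
      finally show ?thesis by (simp add: power_mult)
    qed (use m mn in \<open>simp add: power_0_left\<close>)
    then show ?thesis by (simp add: Q_def poly_monom)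
  qed
  ultimately show ?thesis unfolding algebraic_fun_def by blast
qed

lemma lp_norm_powr:
  assumes "p \<ge> 1"
  shows "lp_norm p x powr p = (\<Sum>i\<in>UNIV. \<bar>x $ i\<bar> powr p)"
proof -
  have "0 \<le> (\<Sum>i\<in>UNIV. \<bar>x $ i\<bar> powr p)" by (intro sum_nonneg) auto
  then show ?thesis using assms by (simp add: lp_norm_def powr_powr)
qed

lemma lp_norm_le_1_iff:
  assumes "p \<ge> 1"
  shows "lp_norm p x \<le> 1 \<longleftrightarrow> (\<Sum>i\<in>UNIV. \<bar>x $ i\<bar> powr p) \<le> 1"
proof -
  have nn: "0 \<le> (\<Sum>i\<in>UNIV. \<bar>x $ i\<bar> powr p)" by (intro sum_nonneg) auto
  have "lp_norm p x \<le> 1 \<Longrightarrow> lp_norm p x powr p \<le> 1 powr p"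
    using assms by (intro powr_mono2) (auto simp: lp_norm_def)
  moreover have "lp_norm p x \<le> 1" if "(\<Sum>i\<in>UNIV. \<bar>x $ i\<bar> powr p) \<le> 1"
    using powr_mono2[of "1 / p", OF _ nn that] assms by (simp add: lp_norm_def)
  ultimately show ?thesis by (auto simp: lp_norm_powr[OF assms])
qed

lemma lp_norm_scale:
  assumes "p \<ge> 1"
  shows "lp_norm p (c *\<^sub>R x) = \<bar>c\<bar> * lp_norm p x"
proof -
  have "(\<Sum>i\<in>UNIV. \<bar>(c *\<^sub>R x) $ i\<bar> powr p) = \<bar>c\<bar> powr p * (\<Sum>i\<in>UNIV. \<bar>x $ i\<bar> powr p)"
    unfolding sum_distrib_left by (intro sum.cong) (auto simp: abs_mult powr_mult)
  moreover have "0 \<le> (\<Sum>i\<in>UNIV. \<bar>x $ i\<bar> powr p)" by (intro sum_nonneg) auto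
  ultimately show ?thesis using assms by (simp add: lp_norm_def powr_mult powr_powr)
qed

lemma lp_norm_eq_0:
  assumes "lp_norm p x = 0"
  shows "x = 0"
proof -
  have "(\<Sum>i\<in>UNIV. \<bar>x $ i\<bar> powr p) = 0" using assms by (simp add: lp_norm_def)
  then have "\<forall>i. \<bar>x $ i\<bar> powr p = 0" by (subst (asm) sum_nonneg_eq_0_iff) auto
  then show ?thesis by (simp add: vec_eq_iff)
qed

text \<open>Minkowski's inequality: the sublevel set of a convex function is convex, so a convex combination
of two normalized vectors stays in the unit ball; scale back by \<open>a + b\<close>.\<close>

lemma lp_norm_triangle:
  fixes x y :: "real^'d"
  assumes "p \<ge> 1"
  shows "lp_norm p (x + y) \<le> lp_norm p x + lp_norm p y"
proof (cases "x = 0 \<or> y = 0")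
  case True
  moreover have "0 \<le> lp_norm p z" for z :: "real^'d" by (simp add: lp_norm_def)
  ultimately show ?thesis by (elim disjE) auto
next
  case False
  define a b where "a = lp_norm p x" and "b = lp_norm p y"
  have "0 \<le> lp_norm p z" for z :: "real^'d" by (simp add: lp_norm_def)
  then have ab: "a > 0" "b > 0"
    using False lp_norm_eq_0[of p x] lp_norm_eq_0[of p y] unfolding a_def b_def by (metis less_eq_real_def)+
  define t where "t = b / (a + b)"
  have t: "0 \<le> t" "t \<le> 1" "1 - t = a / (a + b)" using ab by (auto simp: t_def field_simps)
  define x' y' where "x' = (1 / a) *\<^sub>R x" and "y' = (1 / b) *\<^sub>R y"
  have unit: "lp_norm p x' \<le> 1" "lp_norm p y' \<le> 1"
    using ab by (auto simp: x'_def y'_def lp_norm_scale[OF assms] a_def[symmetric] b_def[symmetric])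
  have eq: "x + y = (a + b) *\<^sub>R ((1 - t) *\<^sub>R x' + t *\<^sub>R y')"
    using ab unfolding t(3) by (simp add: t_def x'_def y'_def scaleR_add_right)
  have "(\<Sum>i\<in>UNIV. \<bar>((1 - t) *\<^sub>R x' + t *\<^sub>R y') $ i\<bar> powr p)
      \<le> (\<Sum>i\<in>UNIV. (1 - t) * \<bar>x' $ i\<bar> powr p + t * \<bar>y' $ i\<bar> powr p)"
    using convex_onD[OF abs_powr_convex[OF assms] t(1,2)] by (intro sum_mono) auto
  also have "\<dots> = (1 - t) * (\<Sum>i\<in>UNIV. \<bar>x' $ i\<bar> powr p) + t * (\<Sum>i\<in>UNIV. \<bar>y' $ i\<bar> powr p)"
    by (simp add: sum.distrib sum_distrib_left)
  also have "\<dots> \<le> (1 - t) * 1 + t * 1"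
    using unit t by (intro add_mono mult_left_mono) (auto simp: lp_norm_le_1_iff[OF assms])
  finally have "lp_norm p ((1 - t) *\<^sub>R x' + t *\<^sub>R y') \<le> 1"
    by (simp add: lp_norm_le_1_iff[OF assms])
  then have "lp_norm p (x + y) \<le> a + b"
    unfolding eq lp_norm_scale[OF assms] using ab by simp
  then show ?thesis by (simp add: a_def b_def)
qed

lemma norm_function_lp_norm: "p \<ge> 1 \<Longrightarrow> norm_function (lp_norm p :: real^'d \<Rightarrow> real)"
  by standard (auto intro: lp_norm_scale lp_norm_triangle lp_norm_eq_0)

lemma lp_norm_polyhedral_gaps:
  assumes "p \<in> \<rat>" "p \<ge> 1"
  shows "polyhedral_gaps (lp_norm p :: real^'d \<Rightarrow> real)"
proof -
  have "polyhedral_gaps (\<lambda>x::real^'d. \<Sum>i\<in>UNIV. \<bar>x $ i\<bar> powr p)"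
    by (intro separable_polyhedral_gaps convex_algebraic_polyhedral_gaps
        abs_powr_convex abs_powr_algebraic assms)
  then have gaps: "polyhedral_gaps (\<lambda>x::real^'d. lp_norm p x powr p)"
    by (simp add: lp_norm_powr[OF assms(2)])
  show ?thesis
  proof (cases "p = 1")
    case True
    have "0 \<le> lp_norm p x" for x :: "real^'d" by (simp add: lp_norm_def)
    then have "(\<lambda>x::real^'d. lp_norm p x powr p) = lp_norm p"
      using True by auto
    then show ?thesis using gaps by simp
  next
    case False
    then show ?thesis
      using norm_function.polyhedral_gaps_of_powr[OF norm_function_lp_norm gaps] assms(2) by auto
  qed
qed

lemma norm_function_block_sum:
  fixes N :: "'a::euclidean_space \<Rightarrow> real"
  assumes "norm_function N"
  shows "norm_function (\<lambda>x::'a^'m. \<Sum>m\<in>UNIV. N (x $ m))"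
proof -
  interpret norm_function N by fact
  show ?thesis
  proof
    show "(\<Sum>m\<in>UNIV. N ((c *\<^sub>R x) $ m)) = \<bar>c\<bar> * (\<Sum>m\<in>UNIV. N (x $ m))" for c and x :: "'a^'m"
      by (simp add: scale sum_distrib_left)
    show "(\<Sum>m\<in>UNIV. N ((x + y) $ m)) \<le> (\<Sum>m\<in>UNIV. N (x $ m)) + (\<Sum>m\<in>UNIV. N (y $ m))"
      for x y :: "'a^'m"
      unfolding sum.distrib[symmetric] by (intro sum_mono) (simp add: triangle)
    show "x = 0" if "(\<Sum>m\<in>UNIV. N (x $ m)) = 0" for x :: "'a^'m"
    proof -
      have "\<forall>m. N (x $ m) = 0" using that by (subst (asm) sum_nonneg_eq_0_iff) auto
      then show ?thesis using definite by (simp add: vec_eq_iff)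
    qed
  qed
qed

text \<open>This and the next lemma present the Huber function as the maximum of the affine functions
\<open>u \<mapsto> s * u - s\<^sup>2 / 2\<close> over \<open>\<bar>s\<bar> \<le> \<delta>\<close>; convexity and linear growth are read off from that.\<close>

lemma huber_scalar_ge:
  assumes "\<delta> > 0" "\<bar>s\<bar> \<le> \<delta>"
  shows "s * u - s\<^sup>2 / 2 \<le> huber_scalar \<delta> u"
proof (cases "\<bar>u\<bar> \<ge> \<delta>")
  case True
  have "s * u \<le> \<bar>s\<bar> * \<bar>u\<bar>" by (metis abs_ge_self abs_mult)
  moreover have "0 \<le> (\<delta> - \<bar>s\<bar>) * (\<bar>u\<bar> - (\<delta> + \<bar>s\<bar>) / 2)"
    using assms True by (intro mult_nonneg_nonneg) auto
  moreover have "(\<delta> - \<bar>s\<bar>) * (\<bar>u\<bar> - (\<delta> + \<bar>s\<bar>) / 2) = \<delta> * (\<bar>u\<bar> - \<delta> / 2) - \<bar>s\<bar> * \<bar>u\<bar> + \<bar>s\<bar>\<^sup>2 / 2"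
    unfolding power2_eq_square by (simp add: field_simps)
  ultimately have "s * u - s\<^sup>2 / 2 \<le> \<delta> * (\<bar>u\<bar> - \<delta> / 2)" unfolding power2_abs by linarith
  then show ?thesis using True by (simp add: huber_scalar_def)
next
  case False
  have "0 \<le> (u - s)\<^sup>2" by simp
  then have "2 * (s * u) \<le> u\<^sup>2 + s\<^sup>2" by (simp add: power2_diff algebra_simps)
  then show ?thesis using False by (simp add: huber_scalar_def)
qed

lemma huber_scalar_attained:
  assumes "\<delta> > 0"
  obtains s where "\<bar>s\<bar> \<le> \<delta>" "huber_scalar \<delta> u = s * u - s\<^sup>2 / 2"
proof (cases "\<bar>u\<bar> \<ge> \<delta>")
  case True
  show thesis
  proof (cases "u > 0")
    case pos: True
    then show thesis
      using True assms that[of \<delta>] by (simp add: huber_scalar_def power2_eq_square algebra_simps)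
  next
    case False
    then show thesis
      using True assms that[of "- \<delta>"] by (simp add: huber_scalar_def power2_eq_square algebra_simps)
  qed
next
  case False
  then show thesis using that[of u] by (auto simp: huber_scalar_def power2_eq_square)
qed

lemma huber_scalar_convex:
  assumes "\<delta> > 0"
  shows "convex_on UNIV (huber_scalar \<delta>)"
proof (rule convex_onI)
  fix t x y :: real assume t: "0 < t" "t < 1"
  obtain s where s: "\<bar>s\<bar> \<le> \<delta>"
    "huber_scalar \<delta> ((1 - t) *\<^sub>R x + t *\<^sub>R y) = s * ((1 - t) *\<^sub>R x + t *\<^sub>R y) - s\<^sup>2 / 2"
    using huber_scalar_attained[OF assms] by blast
  have "s * ((1 - t) *\<^sub>R x + t *\<^sub>R y) - s\<^sup>2 / 2 = (1 - t) * (s * x - s\<^sup>2 / 2) + t * (s * y - s\<^sup>2 / 2)"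
    by (simp add: field_simps)
  also have "\<dots> \<le> (1 - t) * huber_scalar \<delta> x + t * huber_scalar \<delta> y"
    using t s(1) huber_scalar_ge[OF assms] by (intro add_mono mult_left_mono) auto
  finally show "huber_scalar \<delta> ((1 - t) *\<^sub>R x + t *\<^sub>R y)
      \<le> (1 - t) * huber_scalar \<delta> x + t * huber_scalar \<delta> y"
    using s(2) by simp
qed simp

lemma huber_scalar_algebraic: "algebraic_fun (huber_scalar \<delta>)"
proof -
  define Q :: "real poly poly" where
    "Q = [:- [:0, 0, 1 / 2:], 1:] * [:- [:- (\<delta>\<^sup>2 / 2), \<delta>:], 1:] * [:- [:- (\<delta>\<^sup>2 / 2), - \<delta>:], 1:]"
  have "Q \<noteq> 0" unfolding Q_def by simp
  moreover have "poly2 Q z (huber_scalar \<delta> z) = 0" for z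
  proof -
    have "poly2 Q z y = (y - z\<^sup>2 / 2) * (y - \<delta> * (z - \<delta> / 2)) * (y - \<delta> * (- z - \<delta> / 2))" for y
      unfolding Q_def poly2_simps(4)
      by (intro arg_cong2[where f = "(*)"]) (simp_all add: power2_eq_square algebra_simps)
    then show ?thesis by (simp add: huber_scalar_def abs_if)
  qed
  ultimately show ?thesis unfolding algebraic_fun_def by blast
qed

lemma huber_norm_polyhedral_gaps:
  assumes "\<delta> > 0"
  shows "polyhedral_gaps (huber_norm \<delta> :: real^'d \<Rightarrow> real)"
proof -
  have "polyhedral_gaps (\<lambda>x::real^'d. \<Sum>i\<in>UNIV. huber_scalar \<delta> (x $ i))"
    by (intro separable_polyhedral_gaps convex_algebraic_polyhedral_gaps
        huber_scalar_convex huber_scalar_algebraic assms)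
  then show ?thesis by (simp add: huber_norm_def[abs_def])
qed

lemma huber_norm_convex:
  assumes "\<delta> > 0"
  shows "convex_on UNIV (huber_norm \<delta> :: real^'d \<Rightarrow> real)"
proof (rule convex_onI)
  fix t :: real and x y :: "real^'d" assume t: "0 < t" "t < 1"
  have "huber_norm \<delta> ((1 - t) *\<^sub>R x + t *\<^sub>R y)
      \<le> (\<Sum>i\<in>UNIV. (1 - t) * huber_scalar \<delta> (x $ i) + t * huber_scalar \<delta> (y $ i))"
    unfolding huber_norm_def
    using convex_onD[OF huber_scalar_convex[OF assms], of t] t by (intro sum_mono) auto
  then show "huber_norm \<delta> ((1 - t) *\<^sub>R x + t *\<^sub>R y) \<le> (1 - t) * huber_norm \<delta> x + t * huber_norm \<delta> y"
    by (simp add: huber_norm_def sum.distrib sum_distrib_left)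
qed simp

lemma huber_norm_bounded_sublevel:
  assumes "\<delta> > 0"
  shows "bounded {x :: real^'d. huber_norm \<delta> x \<le> B}"
proof -
  have "norm x \<le> (B + real CARD('d) * (\<delta>\<^sup>2 / 2)) / \<delta>" if "huber_norm \<delta> x \<le> B" for x :: "real^'d"
  proof -
    have "\<delta> * \<bar>u\<bar> - \<delta>\<^sup>2 / 2 \<le> huber_scalar \<delta> u" for u
      using huber_scalar_ge[OF assms, of \<delta> u] huber_scalar_ge[OF assms, of "- \<delta>" u] assms
      by (simp add: abs_if)
    then have "(\<Sum>i\<in>UNIV. \<delta> * \<bar>x $ i\<bar> - \<delta>\<^sup>2 / 2) \<le> huber_norm \<delta> x"
      unfolding huber_norm_def by (intro sum_mono)
    then have "\<delta> * (\<Sum>i\<in>UNIV. \<bar>x $ i\<bar>) \<le> B + real CARD('d) * (\<delta>\<^sup>2 / 2)"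
      using that by (simp add: sum_subtractf sum_distrib_left)
    moreover have "\<delta> * norm x \<le> \<delta> * (\<Sum>i\<in>UNIV. \<bar>x $ i\<bar>)"
      using assms by (intro mult_left_mono norm_le_l1_cart) auto
    ultimately have "\<delta> * norm x \<le> B + real CARD('d) * (\<delta>\<^sup>2 / 2)" by linarith
    then show ?thesis using assms by (simp add: le_divide_eq mult.commute)
  qed
  then show ?thesis by (auto simp: bounded_iff)
qed

lemma huber_norm_nonneg: "\<delta> > 0 \<Longrightarrow> 0 \<le> huber_norm \<delta> x"
  unfolding huber_norm_def huber_scalar_def by (intro sum_nonneg) (auto intro: mult_nonneg_nonneg)

section \<open>The proximal gradient method\<close>

text \<open>Each term between the indices \<open>t div 2\<close> and \<open>t\<close> is at least \<open>d t\<close>, and by the Cauchy criterion the sum of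
these terms tends to \<open>0\<close>.\<close>

lemma decseq_summable_tendsto:
  fixes d :: "nat \<Rightarrow> real"
  assumes "decseq d" "summable d" "\<And>t. 0 \<le> d t"
  shows "(\<lambda>t. real t * d t) \<longlonglongrightarrow> 0"
proof (rule tendsto_sandwich[of "\<lambda>_. 0"])
  define S where "S t = (\<Sum>i<t. d i)" for t
  have S: "S \<longlonglongrightarrow> suminf d"
    using assms(2) summable_LIMSEQ unfolding S_def by blast
  have "filterlim (\<lambda>t::nat. t div 2) at_top at_top"
    by (rule filterlim_at_top_div_const_nat) simp
  then have "(\<lambda>t. S (t div 2)) \<longlonglongrightarrow> suminf d"
    by (rule filterlim_compose[OF S])
  then have "(\<lambda>t. 2 * (S t - S (t div 2))) \<longlonglongrightarrow> 2 * (suminf d - suminf d)"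
    by (intro tendsto_intros S)
  then show "(\<lambda>t. 2 * (S t - S (t div 2))) \<longlonglongrightarrow> 0" by simp
  show "eventually (\<lambda>t. real t * d t \<le> 2 * (S t - S (t div 2))) sequentially"
  proof (intro always_eventually allI)
    fix t
    have "real (t - t div 2) * d t = (\<Sum>i\<in>{t div 2..<t}. d t)" by simp
    also have "\<dots> \<le> (\<Sum>i\<in>{t div 2..<t}. d i)"
      using assms(1) by (intro sum_mono) (auto simp: decseq_def)
    also have "\<dots> = S t - S (t div 2)"
      using sum_diff_nat_ivl[of 0 "t div 2" t d] by (simp add: S_def atLeast0LessThan)
    finally have "real (t - t div 2) * d t \<le> S t - S (t div 2)" .
    moreover have "real t / 2 * d t \<le> real (t - t div 2) * d t"
      using assms(3) by (intro mult_right_mono) auto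
    ultimately have "real t / 2 * d t \<le> S t - S (t div 2)" by (rule order_trans[rotated])
    then show "real t * d t \<le> 2 * (S t - S (t div 2))" by simp
  qed
qed (use assms(3) in auto)

lemma smallo_inverse_nat:
  assumes "(\<lambda>t. real t * h t) \<longlonglongrightarrow> 0"
  shows "h \<in> o(\<lambda>t. 1 / real t)"
proof (rule landau_o.smallI)
  fix c :: real assume c: "c > 0"
  have "((\<lambda>t. \<bar>real t * h t\<bar>) \<longlongrightarrow> 0) sequentially"
    using assms by (rule tendsto_rabs_zero)
  then have "eventually (\<lambda>t. \<bar>real t * h t\<bar> < c) sequentially"
    using c by (rule order_tendstoD(2))
  then show "eventually (\<lambda>t. norm (h t) \<le> c * norm (1 / real t)) sequentially"
    using eventually_gt_at_top[of 0]
    by eventually_elim (simp add: abs_mult field_simps)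
qed

lemma gderiv_gradient:
  fixes f :: "'a::euclidean_space \<Rightarrow> real"
  assumes "f differentiable (at x)"
  shows "GDERIV f x :> gradient f x"
proof -
  obtain f' where f': "(f has_derivative f') (at x)" using assms by (auto simp: differentiable_def)
  then have "linear f'" by (rule has_derivative_linear)
  then have "f' h = h \<bullet> adjoint f' 1" for h
    using adjoint_works[of f' h 1] by simp
  then have "GDERIV f x :> adjoint f' 1"
    using f' unfolding gderiv_def by (metis (no_types, lifting) ext)
  moreover from this have "gradient f x = adjoint f' 1"
    unfolding gradient_def
  proof (intro the_equality)
    fix D assume "GDERIV f x :> D" "GDERIV f x :> adjoint f' 1"
    then have "(\<lambda>h. h \<bullet> D) = (\<lambda>h. h \<bullet> adjoint f' 1)"
      unfolding gderiv_def by (rule has_derivative_unique)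
    then have "\<forall>h. h \<bullet> D = h \<bullet> adjoint f' 1" by (simp add: fun_eq_iff)
    then show "D = adjoint f' 1" by (simp only: vector_eq_ldot)
  qed
  ultimately show ?thesis by simp
qed

lemma gderiv_line:
  fixes f :: "'a::real_inner \<Rightarrow> real"
  assumes "GDERIV f (x + t *\<^sub>R d) :> D"
  shows "((\<lambda>t. f (x + t *\<^sub>R d)) has_real_derivative D \<bullet> d) (at t)"
proof -
  have "((\<lambda>t. x + t *\<^sub>R d) has_derivative (\<lambda>h. h *\<^sub>R d)) (at t)"
    by (auto intro!: derivative_eq_intros)
  then have "((\<lambda>t. f (x + t *\<^sub>R d)) has_derivative (\<lambda>h. (h *\<^sub>R d) \<bullet> D)) (at t)"
    using assms unfolding gderiv_def by (rule has_derivative_compose)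
  then show ?thesis
    by (rule has_derivative_imp_has_field_derivative) (simp add: inner_commute)
qed

lemma convex_gradient_ineq:
  fixes f :: "'a::real_inner \<Rightarrow> real"
  assumes conv: "convex_on UNIV f" and D: "GDERIV f x :> D"
  shows "f x + D \<bullet> (y - x) \<le> f y"
proof -
  let ?d = "y - x"
  have "0 \<le> (f y - f x) - D \<bullet> ?d"
  proof (rule deriv_nonneg_of_right_min)
    show "((\<lambda>t. t * (f y - f x) - f (x + t *\<^sub>R ?d)) has_real_derivative (f y - f x) - D \<bullet> ?d) (at 0)"
      using gderiv_line[of f x 0 ?d D] D by (auto intro!: derivative_eq_intros)
    show "0 * (f y - f x) - f (x + 0 *\<^sub>R ?d) \<le> t * (f y - f x) - f (x + t *\<^sub>R ?d)"
      if "0 < t" "t \<le> 1" for t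
    proof -
      have "x + t *\<^sub>R ?d = (1 - t) *\<^sub>R x + t *\<^sub>R y" by (simp add: algebra_simps)
      then show ?thesis using convex_onD[OF conv, of t x y] that by (simp add: algebra_simps)
    qed
  qed
  then show ?thesis by simp
qed

text \<open>The function \<open>t \<mapsto> f (x + t d) + t (g y - g x)\<close> with \<open>d = y - x\<close> is minimal at \<open>t = 0\<close> on \<open>[0, 1]\<close>,
because \<open>g\<close> is convex; its derivative there is the right-hand side. The lemma serves both the
minimizers of \<open>F\<close> and the proximal mapping.\<close>

lemma optimality_subgradient:
  fixes f g :: "'a::real_inner \<Rightarrow> real"
  assumes min: "\<And>y. f x + g x \<le> f y + g y" and D: "GDERIV f x :> D" and conv: "convex_on UNIV g"
  shows "0 \<le> g y - g x + D \<bullet> (y - x)"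
proof -
  let ?d = "y - x"
  have "0 \<le> D \<bullet> ?d + (g y - g x)"
  proof (rule deriv_nonneg_of_right_min)
    show "((\<lambda>t. f (x + t *\<^sub>R ?d) + t * (g y - g x)) has_real_derivative D \<bullet> ?d + (g y - g x)) (at 0)"
      using gderiv_line[of f x 0 ?d D] D by (auto intro!: derivative_eq_intros)
    show "f (x + 0 *\<^sub>R ?d) + 0 * (g y - g x) \<le> f (x + t *\<^sub>R ?d) + t * (g y - g x)"
      if "0 < t" "t \<le> 1" for t
    proof -
      have "x + t *\<^sub>R ?d = (1 - t) *\<^sub>R x + t *\<^sub>R y" by (simp add: algebra_simps)
      then have "g (x + t *\<^sub>R ?d) \<le> (1 - t) * g x + t * g y"
        using convex_onD[OF conv, of t x y] that by simp
      then show ?thesis using min[of "x + t *\<^sub>R ?d"] by (simp add: algebra_simps)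
    qed
  qed
  then show ?thesis by simp
qed

lemma descent_lemma:
  fixes f :: "'a::euclidean_space \<Rightarrow> real"
  assumes smooth: "L_smooth L f"
  shows "f y \<le> f x + gradient f x \<bullet> (y - x) + L / 2 * (norm (y - x))\<^sup>2"
proof -
  let ?d = "y - x"
  let ?h = "\<lambda>t. f (x + t *\<^sub>R ?d) - t * (gradient f x \<bullet> ?d) - L / 2 * t\<^sup>2 * (norm ?d)\<^sup>2"
  have "?h 1 \<le> ?h 0"
  proof (rule DERIV_nonpos_imp_nonincreasing[of 0 1 ?h])
    fix t :: real assume t: "0 \<le> t" "t \<le> 1"
    let ?D = "(gradient f (x + t *\<^sub>R ?d) - gradient f x) \<bullet> ?d - L * t * (norm ?d)\<^sup>2"
    have "GDERIV f (x + t *\<^sub>R ?d) :> gradient f (x + t *\<^sub>R ?d)"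
      using smooth by (intro gderiv_gradient) (auto simp: L_smooth_def)
    then have "(?h has_real_derivative ?D) (at t)"
      by (auto intro!: derivative_eq_intros gderiv_line simp: inner_diff_left)
    moreover have "?D \<le> 0"
    proof -
      have "norm (gradient f (x + t *\<^sub>R ?d) - gradient f x) \<le> L * norm ((x + t *\<^sub>R ?d) - x)"
        using smooth lipschitz_onD[of L UNIV "gradient f" "x + t *\<^sub>R ?d" x]
        by (simp add: L_smooth_def dist_norm)
      then have "norm (gradient f (x + t *\<^sub>R ?d) - gradient f x) * norm ?d \<le> L * (t * norm ?d) * norm ?d"
        using t by (intro mult_right_mono) auto
      moreover have "(gradient f (x + t *\<^sub>R ?d) - gradient f x) \<bullet> ?d
          \<le> norm (gradient f (x + t *\<^sub>R ?d) - gradient f x) * norm ?d"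
        by (rule norm_cauchy_schwarz)
      ultimately show ?thesis by (simp add: power2_eq_square mult.assoc)
    qed
    ultimately show "\<exists>D. (?h has_real_derivative D) (at t) \<and> D \<le> 0" by blast
  qed simp
  then show ?thesis by simp
qed

text \<open>A minimizer exists: outside the ball of radius \<open>sqrt (2 * \<eta> * g u)\<close> the quadratic term alone exceeds
the value at \<open>u\<close>.\<close>

lemma prox_minimizes:
  fixes g :: "'a::euclidean_space \<Rightarrow> real"
  assumes conv: "convex_on UNIV g" and nonneg: "\<And>x. 0 \<le> g x" and \<eta>: "\<eta> > 0"
  shows "1 / 2 * (norm (prox \<eta> g u - u))\<^sup>2 + \<eta> * g (prox \<eta> g u) \<le> 1 / 2 * (norm (y - u))\<^sup>2 + \<eta> * g y"
proof -
  let ?\<phi> = "\<lambda>x. 1 / 2 * (norm (x - u))\<^sup>2 + \<eta> * g x"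
  define r where "r = sqrt (2 * \<eta> * g u)"
  have r: "0 \<le> r" "r\<^sup>2 = 2 * \<eta> * g u" using \<eta> nonneg[of u] by (auto simp: r_def)
  have "continuous_on UNIV g" using conv by (intro convex_on_continuous) auto
  then have "continuous_on (cball u r) ?\<phi>"
    by (intro continuous_intros) (auto intro: continuous_on_subset)
  moreover have "cball u r \<noteq> {}" using r by simp
  ultimately obtain z where z: "z \<in> cball u r" "\<And>x. x \<in> cball u r \<Longrightarrow> ?\<phi> z \<le> ?\<phi> x"
    using continuous_attains_inf[of "cball u r" ?\<phi>] by fastforce
  have "?\<phi> z \<le> ?\<phi> x" for x
  proof (cases "x \<in> cball u r")
    case False
    then have "r\<^sup>2 \<le> (norm (x - u))\<^sup>2"
      using r by (intro power_mono) (auto simp: dist_norm norm_minus_commute)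
    then have "?\<phi> u \<le> ?\<phi> x" using r(2) \<eta> nonneg[of x] by (simp add: add_increasing2)
    moreover have "?\<phi> z \<le> ?\<phi> u" using r by (intro z(2)) auto
    ultimately show ?thesis by linarith
  qed (rule z(2))
  then have "is_arg_min ?\<phi> (\<lambda>x. True) z" by (simp add: is_arg_min_linorder)
  then have "is_arg_min ?\<phi> (\<lambda>x. True) (prox \<eta> g u)"
    unfolding prox_def arg_min_def by (rule someI)
  then show ?thesis by (simp add: is_arg_min_linorder)
qed

lemma prox_three_point:
  fixes g :: "'a::euclidean_space \<Rightarrow> real"
  assumes conv: "convex_on UNIV g" and nonneg: "\<And>x. 0 \<le> g x" and \<eta>: "\<eta> > 0"
  shows "1 / 2 * (norm (prox \<eta> g u - u))\<^sup>2 + \<eta> * g (prox \<eta> g u) + 1 / 2 * (norm (y - prox \<eta> g u))\<^sup>2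
    \<le> 1 / 2 * (norm (y - u))\<^sup>2 + \<eta> * g y"
proof -
  define z where "z = prox \<eta> g u"
  have "GDERIV (\<lambda>x. 1 / 2 * (norm (x - u))\<^sup>2) z :> z - u"
    unfolding gderiv_def power2_norm_eq_inner
    by (auto intro!: derivative_eq_intros simp: inner_commute inner_diff_left inner_diff_right field_simps)
  then have "0 \<le> \<eta> * g y - \<eta> * g z + (z - u) \<bullet> (y - z)"
    using prox_minimizes[OF conv nonneg \<eta>, of u] \<eta>
    by (intro optimality_subgradient[where f = "\<lambda>x. 1 / 2 * (norm (x - u))\<^sup>2"])
      (auto simp: z_def intro!: convex_on_cmul conv)
  moreover have "(norm (y - u))\<^sup>2 = (norm (z - u))\<^sup>2 + 2 * ((z - u) \<bullet> (y - z)) + (norm (y - z))\<^sup>2"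
    unfolding power2_norm_eq_inner by (simp add: inner_diff_left inner_diff_right inner_commute)
  ultimately show ?thesis unfolding z_def[symmetric] by linarith
qed

text \<open>With \<open>y = x\<close> this gives the decrease of \<open>F\<close> in one step, with \<open>y\<close> a minimizer it gives the
telescoping bound on the sum of all gaps.\<close>

lemma prox_step_decrease:
  fixes f g :: "'a::euclidean_space \<Rightarrow> real"
  assumes L: "L > 0" and smooth: "L_smooth L f" and convf: "convex_on UNIV f"
    and convg: "convex_on UNIV g" and nonneg: "\<And>x. 0 \<le> g x"
  defines "z \<equiv> \<lambda>x. prox_step L f g x"
  shows "f (z x) + g (z x) \<le> f y + g y + L / 2 * (norm (x - y))\<^sup>2 - L / 2 * (norm (z x - y))\<^sup>2"
proof -
  define D where "D = gradient f x"
  have expand: "1 / 2 * (norm (w - (x - (1 / L) *\<^sub>R D)))\<^sup>2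
      = 1 / 2 * (norm (w - x))\<^sup>2 + 1 / L * (D \<bullet> (w - x)) + 1 / 2 * (norm ((1 / L) *\<^sub>R D))\<^sup>2" for w
  proof -
    have eq: "w - (x - (1 / L) *\<^sub>R D) = (w - x) + (1 / L) *\<^sub>R D" by simp
    show ?thesis
      unfolding eq power2_norm_eq_inner inner_add_left inner_add_right
      by (simp add: inner_commute field_simps)
  qed
  have "1 / 2 * (norm (z x - x))\<^sup>2 + 1 / L * (D \<bullet> (z x - x)) + 1 / L * g (z x) + 1 / 2 * (norm (y - z x))\<^sup>2
      \<le> 1 / 2 * (norm (y - x))\<^sup>2 + 1 / L * (D \<bullet> (y - x)) + 1 / L * g y"
    using prox_three_point[OF convg nonneg, of "1 / L" "x - (1 / L) *\<^sub>R D" y] L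
    unfolding z_def prox_step_def D_def[symmetric] expand by simp
  then have "L * (1 / 2 * (norm (z x - x))\<^sup>2 + 1 / L * (D \<bullet> (z x - x)) + 1 / L * g (z x) + 1 / 2 * (norm (y - z x))\<^sup>2)
      \<le> L * (1 / 2 * (norm (y - x))\<^sup>2 + 1 / L * (D \<bullet> (y - x)) + 1 / L * g y)"
    using L by (intro mult_left_mono) auto
  then have "L / 2 * (norm (z x - x))\<^sup>2 + D \<bullet> (z x - x) + g (z x) + L / 2 * (norm (y - z x))\<^sup>2
      \<le> L / 2 * (norm (y - x))\<^sup>2 + D \<bullet> (y - x) + g y"
    using L by (simp add: distrib_left)
  moreover have "f (z x) \<le> f x + D \<bullet> (z x - x) + L / 2 * (norm (z x - x))\<^sup>2"
    unfolding D_def by (rule descent_lemma[OF smooth])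
  moreover have "f x + D \<bullet> (y - x) \<le> f y"
    using smooth unfolding D_def
    by (intro convex_gradient_ineq convf gderiv_gradient) (auto simp: L_smooth_def)
  ultimately show ?thesis by (simp add: norm_minus_commute)
qed

text \<open>The gaps \<open>d t\<close> decrease and are summable, which already yields \<open>o(1/t)\<close>. A squared gradient norm is at
most \<open>2 L\<close> times one decrement of \<open>d\<close>. Summing over the second half of the first \<open>t\<close> steps bounds
\<open>t / 2\<close> times the least squared norm by \<open>2 L d (t div 2)\<close>, which is itself \<open>o(1/t)\<close>; so the least norm
is \<open>o(1/t)\<close> after taking the square root.\<close>

theorem PG_little_o:
  fixes f g :: "'a::euclidean_space \<Rightarrow> real"
  assumes L: "L > 0" and smooth: "L_smooth L f" and convf: "convex_on UNIV f"
    and convg: "convex_on UNIV g" and nonneg: "\<And>x. 0 \<le> g x"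
    and min: "xs \<in> minimizers (\<lambda>x. f x + g x)"
  shows "(\<lambda>t. f (PG L f g x0 (t + 1)) + g (PG L f g x0 (t + 1)) - min_value (\<lambda>x. f x + g x))
      \<in> o(\<lambda>t. 1 / real t)" (is ?values)
    and "(\<lambda>t. Min ((\<lambda>\<tau>. norm (prox_gradient L f g (PG L f g x0 \<tau>))) ` {1..t}))
      \<in> o(\<lambda>t. 1 / real t)" (is ?gradients)
proof -
  \<comment> \<open>The index shift skips the duplicated starting point of PG.\<close>
  define X where "X t = PG L f g x0 (t + 1)" for t
  have X_Suc: "X (Suc t) = prox_step L f g (X t)" for t by (simp add: X_def)
  define F where "F x = f x + g x" for x
  have min_F: "min_value (\<lambda>x. f x + g x) = F xs"
    using min_value_eq[OF min] by (simp add: F_def)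
  define d where "d t = F (X t) - F xs" for t
  have d_nonneg: "0 \<le> d t" for t using min by (simp add: d_def F_def minimizers_def)
  note step = prox_step_decrease[OF L smooth convf convg nonneg, folded F_def]
  have drop: "L / 2 * (norm (X t - X (Suc t)))\<^sup>2 \<le> d t - d (Suc t)" for t
    using step[of "X t" "X t"] by (simp add: d_def X_Suc norm_minus_commute)
  have "d (Suc t) \<le> d t" for t
    using drop[of t] L by (smt (verit) mult_nonneg_nonneg zero_le_power2 half_gt_zero)
  then have dec: "decseq d" by (simp add: decseq_Suc_iff)
  have "d (Suc t) \<le> L / 2 * (norm (X t - xs))\<^sup>2 - L / 2 * (norm (X (Suc t) - xs))\<^sup>2" for t
    using step[of "X t" xs] by (simp add: d_def X_Suc)
  then have "(\<Sum>i<t. d (Suc i)) \<le> (\<Sum>i<t. L / 2 * (norm (X i - xs))\<^sup>2 - L / 2 * (norm (X (Suc i) - xs))\<^sup>2)" for t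
    by (intro sum_mono)
  then have telescope: "(\<Sum>i<t. d (Suc i)) \<le> L / 2 * (norm (X 0 - xs))\<^sup>2 - L / 2 * (norm (X t - xs))\<^sup>2" for t
    unfolding sum_lessThan_telescope'[of "\<lambda>i. L / 2 * (norm (X i - xs))\<^sup>2"] .
  have "(\<Sum>i<t. d (Suc i)) \<le> L / 2 * (norm (X 0 - xs))\<^sup>2" for t
  proof -
    have "0 \<le> L / 2 * (norm (X t - xs))\<^sup>2" using L by simp
    then show ?thesis using telescope[of t] by linarith
  qed
  then have "summable (\<lambda>i. d (Suc i))"
    using d_nonneg
    by (intro bounded_imp_summable[where B = "L / 2 * (norm (X 0 - xs))\<^sup>2"])
      (simp_all only: lessThan_Suc_atMost[symmetric])
  then have "summable d" by (simp add: summable_Suc_iff)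
  then have td: "(\<lambda>t. real t * d t) \<longlonglongrightarrow> 0"
    by (intro decseq_summable_tendsto dec d_nonneg)
  then show ?values
    unfolding min_F by (intro smallo_inverse_nat) (simp add: d_def X_def F_def)
  define G where "G i = norm (prox_gradient L f g (X i))" for i
  have G: "(G i)\<^sup>2 \<le> 2 * L * (d i - d (Suc i))" for i
  proof -
    have "(G i)\<^sup>2 = 2 * L * (L / 2 * (norm (X i - X (Suc i)))\<^sup>2)"
      using L by (simp add: G_def prox_gradient_def X_Suc power_mult_distrib power2_eq_square)
    also have "\<dots> \<le> 2 * L * (d i - d (Suc i))"
      using L by (intro mult_left_mono drop) auto
    finally show ?thesis .
  qed
  have "(\<lambda>\<tau>. norm (prox_gradient L f g (PG L f g x0 \<tau>))) ` {1..t} = G ` {..<t}" for t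
  proof -
    have "{1..t} = Suc ` {..<t}" by (simp add: image_Suc_lessThan)
    then show ?thesis by (simp add: image_image G_def X_def)
  qed
  moreover have "(\<lambda>t. real t * Min (G ` {..<t})) \<longlonglongrightarrow> 0"
  proof (rule tendsto_sandwich[of "\<lambda>_. 0"])
    let ?u = "\<lambda>t. sqrt (12 * L * (real (t div 2) * d (t div 2)))"
    have half: "filterlim (\<lambda>t::nat. t div 2) at_top at_top"
      by (rule filterlim_at_top_div_const_nat) simp
    have "?u \<longlonglongrightarrow> sqrt (12 * L * 0)"
      by (intro tendsto_intros filterlim_compose[OF td half])
    then show "?u \<longlonglongrightarrow> 0" by simp
    have Min_bounds: "0 \<le> real t * Min (G ` {..<t}) \<and> real t * Min (G ` {..<t}) \<le> ?u t" if t: "2 \<le> t" for t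
    proof -
      define M where "M = Min (G ` {..<t})"
      define m where "m = t div 2"
      have M_le: "M \<le> G i" if "i < t" for i using that by (simp add: M_def)
      have "M \<in> G ` {..<t}" unfolding M_def using t by (intro Min_in) (auto simp: lessThan_empty_iff)
      then have M_nonneg: "0 \<le> M" by (auto simp: G_def)
      have "real (t - m) * M\<^sup>2 = (\<Sum>i\<in>{m..<t}. M\<^sup>2)" by simp
      also have "\<dots> \<le> (\<Sum>i\<in>{m..<t}. 2 * L * (d i - d (Suc i)))"
      proof (intro sum_mono)
        fix i assume "i \<in> {m..<t}"
        then have "M\<^sup>2 \<le> (G i)\<^sup>2" using M_le M_nonneg by (intro power_mono) auto
        then show "M\<^sup>2 \<le> 2 * L * (d i - d (Suc i))" using G[of i] by linarith
      qed
      also have "\<dots> = 2 * L * (d m - d t)"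
        unfolding sum_distrib_left[symmetric]
        using sum_Suc_diff'[of m t "\<lambda>i. - d i"] by (simp add: m_def)
      also have "\<dots> \<le> 2 * L * d m" using L d_nonneg[of t] by simp
      finally have "real (t - m) * M\<^sup>2 \<le> 2 * L * d m" .
      moreover have "real t / 2 * M\<^sup>2 \<le> real (t - m) * M\<^sup>2"
        by (intro mult_right_mono) (auto simp: m_def)
      ultimately have "real t * M\<^sup>2 \<le> 4 * L * d m" by linarith
      then have "real t * (real t * M\<^sup>2) \<le> real t * (4 * L * d m)" by (intro mult_left_mono) auto
      also have "\<dots> \<le> (3 * real m) * (4 * L * d m)"
      proof (rule mult_right_mono)
        have "t \<le> 3 * m" using t by (simp add: m_def)
        then show "real t \<le> 3 * real m" by simp
      qed (use L d_nonneg[of m] in auto)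
      finally have "(real t * M)\<^sup>2 \<le> 12 * L * (real m * d m)"
        by (simp add: power2_eq_square algebra_simps)
      then have "real t * M \<le> sqrt (12 * L * (real m * d m))" by (rule real_le_rsqrt)
      then show ?thesis using M_nonneg by (simp add: M_def m_def)
    qed
    show "eventually (\<lambda>t. 0 \<le> real t * Min (G ` {..<t})) sequentially"
      using eventually_ge_at_top[of 2] by eventually_elim (use Min_bounds in blast)
    show "eventually (\<lambda>t. real t * Min (G ` {..<t}) \<le> ?u t) sequentially"
      using eventually_ge_at_top[of 2] by eventually_elim (use Min_bounds in blast)
  qed simp
  ultimately show ?gradients by (intro smallo_inverse_nat) simp
qed

section \<open>Regularized risks\<close>

lemma minimizers_nonempty:
  fixes F :: "'a::euclidean_space \<Rightarrow> real"
  assumes "continuous_on UNIV F" "bounded {x. F x \<le> F 0}"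
  shows "minimizers F \<noteq> {}"
proof -
  define K where "K = {x. F x \<le> F 0}"
  have "closed K"
    unfolding K_def using assms(1) by (intro closed_Collect_le continuous_on_const)
  then have "compact K" using assms(2) by (simp add: K_def compact_eq_bounded_closed)
  moreover have "K \<noteq> {}" by (auto simp: K_def)
  moreover have "continuous_on K F" using assms(1) continuous_on_subset by blast
  ultimately have "\<exists>z\<in>K. \<forall>x\<in>K. F z \<le> F x" by (rule continuous_attains_inf)
  then obtain z where z: "F z \<le> F 0" "\<And>x. F x \<le> F 0 \<Longrightarrow> F z \<le> F x"
    unfolding K_def by blast
  have "F z \<le> F x" for x
    using z(2)[of x] z(1) by linarith
  then show ?thesis unfolding minimizers_def by blast
qed

definition HEB_and_PG_rate :: "('a::euclidean_space \<Rightarrow> real) \<Rightarrow> ('a \<Rightarrow> real) \<Rightarrow> bool" where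
  "HEB_and_PG_rate f g \<longleftrightarrow>
     (\<forall>\<xi>>0. \<exists>\<theta>. 0 < \<theta> \<and> \<theta> \<le> 1 \<and> HEB_on (\<lambda>x. f x + g x) \<theta> (sublevel (\<lambda>x. f x + g x) \<xi>)) \<and>
     (\<forall>L>0. L_smooth L f \<longrightarrow>
       (\<forall>x0.
         (\<lambda>t. f (PG L f g x0 (t + 1)) + g (PG L f g x0 (t + 1)) - min_value (\<lambda>x. f x + g x))
           \<in> o(\<lambda>t. 1 / real t) \<and>
         (\<lambda>t. Min ((\<lambda>\<tau>. norm (prox_gradient L f g (PG L f g x0 \<tau>))) ` {1..t}))
           \<in> o(\<lambda>t. 1 / real t)))"

text \<open>Both objectives are instances: the second one has index pairs \<open>(i, m)\<close> and the vector \<open>a i\<close> placed in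
block \<open>m\<close>.\<close>

locale regularized_risk =
  fixes J :: "'j set" and l :: "'j \<Rightarrow> real \<Rightarrow> real" and v :: "'j \<Rightarrow> 'a::euclidean_space"
    and c lam :: real and R :: "'a \<Rightarrow> real"
  assumes finite_J: "finite J" and c: "c > 0" and lam: "lam > 0"
    and l_nonneg: "\<And>j z. 0 \<le> l j z" and l_convex: "\<And>j. convex_on UNIV (l j)"
    and l_diff: "\<And>j z. l j differentiable (at z)" and l_algebraic: "\<And>j. algebraic_fun (l j)"
    and R_convex: "convex_on UNIV R" and R_nonneg: "\<And>x. 0 \<le> R x"
    and R_gaps: "polyhedral_gaps R" and R_coercive: "\<And>B. bounded {x. R x \<le> B}"
begin

definition f where "f x = c * (\<Sum>j\<in>J. l j (x \<bullet> v j))"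
definition g where "g x = lam * R x"
definition F where "F x = f x + g x"

lemma g_convex: "convex_on UNIV g"
  unfolding g_def using lam R_convex by (intro convex_on_cmul) auto

lemma f_convex: "convex_on UNIV f"
proof (rule convex_onI)
  fix t :: real and x y :: 'a assume t: "0 < t" "t < 1"
  have "(\<Sum>j\<in>J. l j (((1 - t) *\<^sub>R x + t *\<^sub>R y) \<bullet> v j))
      \<le> (\<Sum>j\<in>J. (1 - t) * l j (x \<bullet> v j) + t * l j (y \<bullet> v j))"
    using convex_onD[OF l_convex, of t] t by (intro sum_mono) (auto simp: inner_add_left)
  then have "f ((1 - t) *\<^sub>R x + t *\<^sub>R y) \<le> c * (\<Sum>j\<in>J. (1 - t) * l j (x \<bullet> v j) + t * l j (y \<bullet> v j))"
    unfolding f_def using c by (intro mult_left_mono) auto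
  then show "f ((1 - t) *\<^sub>R x + t *\<^sub>R y) \<le> (1 - t) * f x + t * f y"
    by (simp add: f_def sum.distrib distrib_left mult.left_commute flip: sum_distrib_left)
qed simp

lemma f_nonneg: "0 \<le> f x"
  unfolding f_def using c l_nonneg by (intro mult_nonneg_nonneg sum_nonneg) auto

lemma g_nonneg: "0 \<le> g x"
  unfolding g_def using lam R_nonneg by simp

lemma F_sublevel_bounded: "bounded {x. F x \<le> B}"
proof (rule bounded_subset)
  show "bounded {x. R x \<le> B / lam}" by (rule R_coercive)
  have "R x \<le> B / lam" if "F x \<le> B" for x
    using that f_nonneg[of x] lam by (simp add: F_def g_def field_simps)
  then show "{x. F x \<le> B} \<subseteq> {x. R x \<le> B / lam}" by auto
qed

lemma minimizers_F_nonempty: "minimizers F \<noteq> {}"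
proof (rule minimizers_nonempty)
  have "convex_on UNIV F"
    unfolding F_def by (intro convex_on_add f_convex g_convex)
  then show "continuous_on UNIV F" by (intro convex_on_continuous) auto
qed (rule F_sublevel_bounded)

definition grad where "grad x = c *\<^sub>R (\<Sum>j\<in>J. deriv (l j) (x \<bullet> v j) *\<^sub>R v j)"

lemma l_deriv: "(l j has_real_derivative deriv (l j) z) (at z)"
  using l_diff[of j z] by (simp add: DERIV_deriv_iff_real_differentiable)

lemma f_gderiv: "GDERIV f x :> grad x"
proof -
  have "((\<lambda>x. l j (x \<bullet> v j)) has_derivative (\<lambda>h. (h \<bullet> v j) * deriv (l j) (x \<bullet> v j))) (at x)" for j
  proof -
    have "((\<lambda>x. x \<bullet> v j) has_derivative (\<lambda>h. h \<bullet> v j)) (at x)"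
      by (auto intro!: derivative_eq_intros)
    moreover have "(l j has_derivative (\<lambda>h. h * deriv (l j) (x \<bullet> v j))) (at (x \<bullet> v j))"
      using l_deriv by (simp add: has_field_derivative_def mult_commute_abs)
    ultimately show ?thesis by (rule has_derivative_compose)
  qed
  then have "(f has_derivative (\<lambda>h. c * (\<Sum>j\<in>J. (h \<bullet> v j) * deriv (l j) (x \<bullet> v j)))) (at x)"
    unfolding f_def[abs_def] by (intro has_derivative_mult_right has_derivative_sum)
  moreover have "(\<lambda>h. c * (\<Sum>j\<in>J. (h \<bullet> v j) * deriv (l j) (x \<bullet> v j))) = (\<lambda>h. h \<bullet> grad x)"
    by (auto simp: grad_def inner_sum_right mult.commute)
  ultimately show ?thesis unfolding gderiv_def by simp
qed

text \<open>The first-order condition says that \<open>- grad xs / lam\<close> is a subgradient of \<open>R\<close> at \<open>xs\<close>. The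
linear terms cancel, so \<open>F - F xs\<close> is the sum of the gaps of the losses and of the gap of \<open>R\<close>, all of them
nonnegative.\<close>

lemma F_gap_error_bound:
  assumes min: "xs \<in> minimizers F"
  shows "polyhedral_error_bound (\<lambda>x. F x - F xs)"
proof -
  define gap where "gap j = bregman (l j) (xs \<bullet> v j) (deriv (l j) (xs \<bullet> v j))" for j
  define w where "w = - (1 / lam) *\<^sub>R grad xs"
  have gap_nonneg: "0 \<le> gap j z" for j z
    using convex_on_imp_above_tangent[OF l_convex, of "xs \<bullet> v j" z j "deriv (l j) (xs \<bullet> v j)"] l_deriv
    by (simp add: gap_def bregman_def)
  have "polyhedral_error_bound (gap j)" for j
    using convex_algebraic_polyhedral_gaps[OF l_convex l_algebraic, of j] gap_nonneg[of j]
    unfolding polyhedral_gaps_def gap_def by blast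
  then have "polyhedral_error_bound (\<lambda>x. gap j (x \<bullet> v j))" for j
    by (rule polyhedral_error_bound_linear)
      (simp add: bounded_linear.linear bounded_linear_inner_left)
  then have loss: "polyhedral_error_bound (\<lambda>x. c * (\<Sum>j\<in>J. gap j (x \<bullet> v j)))"
    by (intro polyhedral_error_bound_cmult polyhedral_error_bound_sum finite_J c)
  have "0 \<le> bregman R xs w x" for x
  proof -
    have "0 \<le> g x - g xs + grad xs \<bullet> (x - xs)"
      using min by (intro optimality_subgradient[OF _ f_gderiv g_convex])
        (auto simp: minimizers_def F_def)
    also have "\<dots> = lam * bregman R xs w x"
      using lam by (simp add: bregman_def g_def w_def algebra_simps)
    finally show ?thesis using lam by (simp add: zero_le_mult_iff)
  qed
  then have reg: "polyhedral_error_bound (\<lambda>x. lam * bregman R xs w x)"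
    using R_gaps lam unfolding polyhedral_gaps_def by (intro polyhedral_error_bound_cmult) auto
  have "F x - F xs = c * (\<Sum>j\<in>J. gap j (x \<bullet> v j)) + lam * bregman R xs w x" for x
  proof -
    have "c * (\<Sum>j\<in>J. gap j (x \<bullet> v j)) = f x - f xs - grad xs \<bullet> (x - xs)"
    proof -
      have "gap j (x \<bullet> v j) = l j (x \<bullet> v j) - l j (xs \<bullet> v j) - (deriv (l j) (xs \<bullet> v j) *\<^sub>R v j) \<bullet> (x - xs)" for j
        by (simp add: gap_def bregman_def inner_diff_right inner_commute)
      then show ?thesis
        by (simp add: f_def grad_def sum_subtractf right_diff_distrib inner_sum_left)
    qed
    moreover have "lam * bregman R xs w x = g x - g xs + grad xs \<bullet> (x - xs)"
      using lam by (simp add: bregman_def g_def w_def algebra_simps)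
    ultimately show ?thesis by (simp add: F_def)
  qed
  then show ?thesis using polyhedral_error_bound_add[OF loss reg] by simp
qed

theorem HEB:
  assumes "\<xi> > 0"
  shows "\<exists>\<theta>. 0 < \<theta> \<and> \<theta> \<le> 1 \<and> HEB_on F \<theta> (sublevel F \<xi>)"
proof -
  obtain xs where xs: "xs \<in> minimizers F" using minimizers_F_nonempty by blast
  have "sublevel F \<xi> = {x. F x \<le> min_value F + \<xi>}" by (auto simp: sublevel_def)
  then have "bounded (sublevel F \<xi>)" using F_sublevel_bounded by simp
  then show ?thesis by (rule HEB_on_polyhedral[OF xs F_gap_error_bound[OF xs] _ assms])
qed

theorem HEB_and_PG_rate: "HEB_and_PG_rate f g"
proof -
  obtain xs where xs: "xs \<in> minimizers F" using minimizers_F_nonempty by blast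
  then have "xs \<in> minimizers (\<lambda>x. f x + g x)" by (simp add: F_def[abs_def])
  note rate = PG_little_o[OF _ _ f_convex g_convex g_nonneg this, folded F_def]
  show ?thesis
    unfolding HEB_and_PG_rate_def using HEB[unfolded F_def[abs_def]] rate[unfolded F_def[abs_def]] by blast
qed

end

theorem corollary2:
  fixes loss :: "real \<Rightarrow> 'b \<Rightarrow> real"
    and n :: nat
    and a :: "nat \<Rightarrow> real^'d"
    and b :: "nat \<Rightarrow> 'b"
    and b' :: "nat \<Rightarrow> 'm::finite \<Rightarrow> 'b"
    and lam :: real
  assumes "n \<ge> 1" and "lam > 0"
    and "\<And>y z. loss z y \<ge> 0"
    and "\<And>y. convex_on UNIV (\<lambda>z. loss z y)"
    and "\<And>y z. (\<lambda>z. loss z y) differentiable (at z)"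
    and "\<And>y. \<exists>C. C-lipschitz_on UNIV (deriv (\<lambda>z. loss z y))"
    and "\<And>y. semialgebraic_function (\<lambda>z. loss z y)"
  shows
    "(\<forall>R :: real^'d \<Rightarrow> real.
        (\<exists>p s. p \<in> \<rat> \<and> p \<ge> 1 \<and> s \<ge> (1::nat) \<and> R = (\<lambda>x. lp_norm p x ^ s)) \<or>
        (\<exists>\<delta>>0. R = huber_norm \<delta>) \<longrightarrow>
        (let f = avg_loss loss n a b; g = (\<lambda>x. lam * R x); F = (\<lambda>x. f x + g x) in
          (\<forall>\<xi>>0. \<exists>\<theta>. 0 < \<theta> \<and> \<theta> \<le> 1 \<and> HEB_on F \<theta> (sublevel F \<xi>)) \<and>
          (\<forall>L>0. L_smooth L f \<longrightarrow>
            (\<forall>x0.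
              (\<lambda>t. F (PG L f g x0 (t + 1)) - min_value F) \<in> o(\<lambda>t. 1 / real t) \<and>
              (\<lambda>t. Min ((\<lambda>\<tau>. norm (prox_gradient L f g (PG L f g x0 \<tau>))) ` {1..t}))
                \<in> o(\<lambda>t. 1 / real t)))))
     \<and>
     (\<forall>p. p \<in> \<rat> \<and> p \<ge> 1 \<longrightarrow>
        (let f = multi_avg_loss loss n a b';
             g = (\<lambda>x :: real^'d^'m. lam * (\<Sum>m\<in>UNIV. lp_norm p (x $ m)));
             F = (\<lambda>x. f x + g x) in
          (\<forall>\<xi>>0. \<exists>\<theta>. 0 < \<theta> \<and> \<theta> \<le> 1 \<and> HEB_on F \<theta> (sublevel F \<xi>)) \<and>
          (\<forall>L>0. L_smooth L f \<longrightarrow>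
            (\<forall>x0.
              (\<lambda>t. F (PG L f g x0 (t + 1)) - min_value F) \<in> o(\<lambda>t. 1 / real t) \<and>
              (\<lambda>t. Min ((\<lambda>\<tau>. norm (prox_gradient L f g (PG L f g x0 \<tau>))) ` {1..t}))
                \<in> o(\<lambda>t. 1 / real t)))))"
proof -
  note loss = assms(3-5,7)
  have single: "HEB_and_PG_rate f g"
    if R: "convex_on UNIV R" "\<And>x. 0 \<le> R x" "polyhedral_gaps R" "\<And>B. bounded {x. R x \<le> B}"
      and defs: "f = avg_loss loss n a b" "g = (\<lambda>x. lam * R x)"
    for R :: "real^'d \<Rightarrow> real" and f g
  proof -
    interpret r: regularized_risk "{1..n}" "\<lambda>i z. loss z (b i)" a "1 / real n" lam R
      using assms(1,2) loss R semialgebraic_imp_algebraic_fun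
      by unfold_locales auto
    have "f = r.f" "g = r.g"
      by (simp_all only: fun_eq_iff defs r.f_def r.g_def avg_loss_def simp_thms)
    then show ?thesis using r.HEB_and_PG_rate by simp
  qed
  have multi: "HEB_and_PG_rate f g"
    if p: "p \<in> \<rat>" "p \<ge> 1" and defs: "f = multi_avg_loss loss n a b'"
      "g = (\<lambda>x :: real^'d^'m. lam * (\<Sum>m\<in>UNIV. lp_norm p (x $ m)))"
    for p f g
  proof -
    let ?R = "\<lambda>x :: real^'d^'m. \<Sum>m\<in>UNIV. lp_norm p (x $ m)"
    interpret N: norm_function ?R
      using p(2) by (intro norm_function_block_sum norm_function_lp_norm)
    have gaps: "polyhedral_gaps ?R"
      by (intro separable_polyhedral_gaps lp_norm_polyhedral_gaps p)
    have bdd: "bounded {x. ?R x \<le> B}" for B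
      using N.bounded_power_sublevel[of 1 B] by simp
    interpret r: regularized_risk "{1..n} \<times> (UNIV :: 'm set)" "\<lambda>(i, m) z. loss z (b' i m)"
      "\<lambda>(i, m). axis m (a i)" "1 / real n" lam ?R
    proof
      show "\<And>j z. 0 \<le> (case j of (i, m) \<Rightarrow> \<lambda>z. loss z (b' i m)) z"
        "\<And>j. convex_on UNIV (case j of (i, m) \<Rightarrow> \<lambda>z. loss z (b' i m))"
        "\<And>j z. (case j of (i, m) \<Rightarrow> \<lambda>z. loss z (b' i m)) differentiable (at z)"
        "\<And>j. algebraic_fun (case j of (i, m) \<Rightarrow> \<lambda>z. loss z (b' i m))"
        using loss semialgebraic_imp_algebraic_fun by (auto split: prod.splits)
    qed (use assms(1,2) N.convex N.nonneg gaps bdd in auto)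
    have "f = r.f"
      unfolding fun_eq_iff defs multi_avg_loss_def r.f_def sum.cartesian_product
      by (intro allI arg_cong2[where f = "(*)"] refl sum.cong) (auto simp: inner_axis)
    moreover have "g = r.g" by (simp add: fun_eq_iff defs r.g_def)
    ultimately show ?thesis using r.HEB_and_PG_rate by simp
  qed
  have norm_power: "convex_on UNIV R" "0 \<le> R x" "polyhedral_gaps R" "bounded {x. R x \<le> B}"
    if "p \<in> \<rat>" "p \<ge> 1" "s \<ge> (1::nat)" "R = (\<lambda>x. lp_norm p x ^ s)"
    for p s B x and R :: "real^'d \<Rightarrow> real"
  proof -
    interpret N: norm_function "lp_norm p :: real^'d \<Rightarrow> real"
      using that(2) by (rule norm_function_lp_norm)
    show "convex_on UNIV R" "0 \<le> R x" "polyhedral_gaps R" "bounded {x. R x \<le> B}"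
      unfolding that(4)
      using N.convex_power N.nonneg N.polyhedral_gaps_power[OF lp_norm_polyhedral_gaps[OF that(1,2)] that(3)]
        N.bounded_power_sublevel[OF that(3)] by auto
  qed
  show ?thesis
    unfolding Let_def HEB_and_PG_rate_def[symmetric]
  proof ((rule conjI; intro allI impI), goal_cases)
    case (1 R)
    then show ?case
    proof (elim disjE exE conjE)
      fix p s assume *: "p \<in> \<rat>" "p \<ge> 1" "s \<ge> (1::nat)" "R = (\<lambda>x. lp_norm p x ^ s)"
      show ?case by (rule single[OF norm_power[OF *] refl refl])
    next
      fix \<delta> :: real assume *: "\<delta> > 0" "R = huber_norm \<delta>"
      show ?case
        by (rule single[OF _ _ _ _ refl refl])
          (simp_all add: * huber_norm_convex huber_norm_nonneg huber_norm_polyhedral_gaps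
            huber_norm_bounded_sublevel)
    qed
  next
    case (2 p)
    then show ?case by (intro multi[OF _ _ refl refl]) auto
  qed
qed

end
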